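(* Let $\xi,\xi_1,\xi_2,\ldots$ be independent and identically distributed real random variables with finite mean $a:=\mathbb{E}\xi>0$. Let $S_0=0$, $S_n=\xi_1+\ldots+\xi_n$ for $n\ge 1$, and $M_n=\max_{0\le i\le n}S_i$. Let $\tau$ be a counting random variable whose distribution is intermediate regularly varying at infinity and such that $$\mathbb{P}\{|\xi|>x\} = o\left(\frac{\mathbb{P}\{\tau>x\}}{\mathbb{E}(\tau\wedge x)}\right)\quad\text{as }x\to\infty.$$ If $\tau$ does not depend on the future of the sequence $\{\xi_n\}$, then $$\mathbb{P}\{M_\tau>x\}\ \sim\ \mathbb{P}\{S_\tau>x\}\ \sim\ \mathbb{P}\{\tau>x/a\}\quad\text{as }x\to\infty.$$
   Context: A counting random variable is a random variable with values in the non-negative integers (defined on the same probability space as $\{\xi_n\}$). $\tau\wedge x=\min(\tau,x)$. $\mathbb{I}\{A\}$ denotes the indicator of the event $A$. For eventually positive functions $f,g$: $f(x)\sim g(x)$ means $f(x)/g(x)\to1$ as $x\to\infty$, and $f(x)=o(g(x))$ means $f(x)/g(x)\to 0$ as $x\to\infty$ (for the latter $f$ need only be non-negative). Independence of the future: a counting random variable $\tau$ does not depend on (is independent of) the future of the sequence $\{\xi_n\}$ if, for every $n\ge1$, the sigma-algebras $\sigma\{\xi_i,\ i\le n,\ \mathbb{I}\{\tau\le n\}\}$ and $\sigma\{\xi_i,\ i>n\}$ are independent. Intermediate regular variation: a distribution $G$ with tail $\overline G(x)=G((x,\infty))$, positive for all $x$, is intermediate regularly varying at infinity if $$\lim_{\varepsilon\downarrow0}\limsup_{x\to\infty}\frac{\overline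 G((1-\varepsilon)x)}{\overline G(x)}=1.$$ *)

theory Defs
  imports "HOL-Probability.Probability" "HOL-Library.Landau_Symbols"
begin

definition tail :: "real measure \<Rightarrow> real \<Rightarrow> real" where
  "tail G x = measure G {x<..}"

(* The upper limit is taken in ereal, where it exists even if the ratio is unbounded. *)
definition intermediate_regularly_varying :: "real measure \<Rightarrow> bool" where
  "intermediate_regularly_varying G \<longleftrightarrow>
     (\<forall>x. tail G x > 0) \<and>
     ((\<lambda>\<epsilon>::real. Limsup at_top (\<lambda>x. ereal (tail G ((1 - \<epsilon>) * x) / tail G x)))
        \<longlongrightarrow> 1) (at_right 0)"

definition gen_sigma :: "'a set \<Rightarrow> ('a \<Rightarrow> real) set \<Rightarrow> 'a set set" where
  "gen_sigma \<Omega> F = sigma_sets \<Omega> (\<Union>f\<in>F. {f -` A \<inter> \<Omega> | A. A \<in> sets borel})"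

(* The sequence is indexed from 1; the value X 0 plays no role here or below. *)
definition indep_of_future :: "'a measure \<Rightarrow> (nat \<Rightarrow> 'a \<Rightarrow> real) \<Rightarrow> ('a \<Rightarrow> nat) \<Rightarrow> bool" where
  "indep_of_future M X \<tau> \<longleftrightarrow>
     (\<forall>n\<ge>1. prob_space.indep_set M
        (gen_sigma (space M) (X ` {1..n} \<union> {indicator {\<omega>. \<tau> \<omega> \<le> n}}))
        (gen_sigma (space M) (X ` {n<..})))"

definition partial_sum :: "(nat \<Rightarrow> 'a \<Rightarrow> real) \<Rightarrow> nat \<Rightarrow> 'a \<Rightarrow> real" where
  "partial_sum X n \<omega> = (\<Sum>i=1..n. X i \<omega>)"

definition running_max :: "(nat \<Rightarrow> 'a \<Rightarrow> real) \<Rightarrow> nat \<Rightarrow> 'a \<Rightarrow> real" where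
  "running_max X n \<omega> = Max ((\<lambda>i. partial_sum X i \<omega>) ` {0..n})"

end

theory Submission
  imports Defs
begin

text \<open>
Let \<open>S k = X 1 + ... + X k\<close>, \<open>F x = P(\<tau> > x)\<close> and \<open>G x = E (min \<tau> x)\<close>. Light steps make
the walk follow its drift \<open>k * a\<close>, so \<open>S \<tau>\<close> and the maximum up to \<open>\<tau>\<close> exceed \<open>x\<close> essentially
when \<open>\<tau>\<close> exceeds \<open>x / a\<close>. Two facts turn this into an asymptotic equivalence.

The first one (\<open>deviation_negligible\<close>) is that
\<open>P(\<exists>k \<le> min \<tau> x. \<bar>S k - k * a\<bar> > \<epsilon> * x) = o(F x)\<close> for every \<open>\<epsilon> > 0\<close>. A step is taken only
while the walk is alive, and (for every step but the first) being alive is independent of the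
step; hence some step taken exceeds \<open>\<beta> * x\<close> with probability at most of order \<open>G x * P(\<bar>\<xi>\<bar> > \<beta> * x)\<close>, which is \<open>o(F x)\<close>
by hypothesis. For the walk with steps truncated at \<open>\<beta> * x\<close>, Kolmogorov's inequality,
in the version \<open>kolmogorov_while_alive\<close> which counts each step with the probability that it is taken,
gives a bound of order \<open>G x / x * v x\<close>, where \<open>v x = E (min (\<xi>\<^sup>2) (x\<^sup>2)) / x\<close> tends to 0.
That can be far larger than \<open>F x\<close>, for instance when \<open>\<tau>\<close> has a finite mean. But a walk with
steps below \<open>\<beta> * x\<close> needs to cross many levels, one after the other, to get as far as
\<open>\<epsilon> * x\<close>, and each further level costs another factor of order \<open>v x\<close>
(\<open>prob_escape_power\<close>). The tail \<open>F\<close> varies dominatedly, and with the hypothesis on \<open>\<xi>\<close>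
this yields \<open>v x ^ k = O(x * F x / G x)\<close> for some \<open>k\<close> (\<open>moment_power_bound\<close>), so with that many
levels the bound becomes \<open>o(F x)\<close>.

The second fact (\<open>no_later_drop\<close>) is that after any time \<open>N\<close> the walk ever falls below
\<open>S N - y\<close> with a probability that tends to 0 as \<open>y\<close> grows, uniformly in \<open>N\<close>. Such a drop is
independent of \<open>{\<tau> > N}\<close>, so it costs only a small fraction of \<open>F N\<close>, no matter how
long the walk continues and how \<open>\<tau>\<close> depends on the walk before \<open>N\<close>.

The first fact bounds the tail of the maximum by \<open>(1 + o(1)) F (r * x / a)\<close> for each \<open>r < 1\<close>. Both
together bound the tail of \<open>S \<tau>\<close> from below by \<open>(1 - o(1)) F (x / (r * a))\<close>. Intermediate
regular variation is exactly what makes these tails agree with \<open>F (x / a)\<close> as \<open>r\<close>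
tends to 1.
\<close>

section \<open>Kolmogorov's inequality for a walk that may die\<close>

text \<open>Independence of the future ties \<open>{\<tau> \<le> n}\<close> to the steps up to \<open>n\<close> for one \<open>n\<close> at a
time, and the past of \<open>n\<close> that this describes need not contain \<open>{\<tau> \<le> m}\<close> for \<open>m < n\<close>. The
pasts are therefore a family of sigma-algebras rather than a filtration.\<close>

locale past_future = prob_space M for M :: "'a measure" +
  fixes past future :: "nat \<Rightarrow> 'a measure"
  assumes space_past [simp]: "space (past n) = space M"
    and space_future [simp]: "space (future n) = space M"
    and sets_past: "sets (past n) \<subseteq> events"
    and sets_future: "sets (future n) \<subseteq> events"
    and past_indep_future:
      "\<And>A B. A \<in> sets (past n) \<Longrightarrow> B \<in> sets (future n) \<Longrightarrow> prob (A \<inter> B) = prob A * prob B"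
begin

lemma past_measurable:
  assumes "f \<in> borel_measurable (past n)"
  shows "f \<in> borel_measurable M"
proof -
  have "subalgebra M (past n)"
    unfolding subalgebra_def using sets_past by simp
  then show ?thesis using assms by (rule measurable_from_subalg)
qed

lemma future_measurable:
  assumes "f \<in> borel_measurable (future n)"
  shows "f \<in> borel_measurable M"
proof -
  have "subalgebra M (future n)"
    unfolding subalgebra_def using sets_future by simp
  then show ?thesis using assms by (rule measurable_from_subalg)
qed

lemma
  assumes Z: "Z \<in> borel_measurable (past n)" and W: "W \<in> borel_measurable (future n)"
    and int: "integrable M Z" "integrable M W"
  shows integrable_past_times_future: "integrable M (\<lambda>\<omega>. Z \<omega> * W \<omega> :: real)"
    and expectation_past_times_future:
      "expectation (\<lambda>\<omega>. Z \<omega> * W \<omega>) = expectation Z * expectation W"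
proof -
  have "indep_var borel Z borel W"
  proof (rule indep_var_eq[THEN iffD2], intro conjI)
    show "random_variable borel Z" "random_variable borel W"
      using past_measurable[OF Z] future_measurable[OF W] .
    have Z': "sigma_sets (space M) {Z -` A \<inter> space M |A. A \<in> sets borel} \<subseteq> sets (past n)"
      using Z sets.sigma_sets_subset[of "{Z -` A \<inter> space M |A. A \<in> sets borel}" "past n"]
      by (auto simp: measurable_def)
    have W': "sigma_sets (space M) {W -` A \<inter> space M |A. A \<in> sets borel} \<subseteq> sets (future n)"
      using W sets.sigma_sets_subset[of "{W -` A \<inter> space M |A. A \<in> sets borel}" "future n"]
      by (auto simp: measurable_def)
    show "indep_set (sigma_sets (space M) {Z -` A \<inter> space M |A. A \<in> sets borel})
       (sigma_sets (space M) {W -` A \<inter> space M |A. A \<in> sets borel})"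
      using Z' W' past_indep_future[of _ n] sets_past[of n] sets_future[of n]
      unfolding indep_sets2_eq by (meson subset_iff subset_trans)
  qed
  from indep_var_lebesgue_integral[OF this int] indep_var_integrable[OF this int]
  show "expectation (\<lambda>\<omega>. Z \<omega> * W \<omega>) = expectation Z * expectation W"
    "integrable M (\<lambda>\<omega>. Z \<omega> * W \<omega>)" .
qed

text \<open>Kolmogorov's maximal inequality for a sum that takes step \<open>i + 1\<close> only on the event
\<open>B i\<close>, so that this step contributes its variance multiplied by the probability of
\<open>B i\<close>. Stop the sum when it first leaves \<open>[-y, y]\<close> and let \<open>A i\<close> be the event that step
\<open>i + 1\<close> is still taken. On \<open>A i\<close> the stopped sum coincides with the full sum \<open>S i\<close>, so
the mixed term in the square is the product of \<open>S i\<close> restricted to \<open>A i\<close>, which is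
determined by the past of \<open>i\<close>, with a centred future step: its mean vanishes. Each
such product involves the past and the future of a single index.\<close>

lemma kolmogorov_while_alive:
  fixes Y :: "nat \<Rightarrow> 'a \<Rightarrow> real" and B :: "nat \<Rightarrow> 'a set"
  assumes Y_past: "\<And>i j. s < j \<Longrightarrow> j \<le> i \<Longrightarrow> Y j \<in> borel_measurable (past i)"
    and Y_future: "\<And>i. s \<le> i \<Longrightarrow> Y (Suc i) \<in> borel_measurable (future i)"
    and Y_sq: "\<And>i. s < i \<Longrightarrow> integrable M (\<lambda>\<omega>. (Y i \<omega>)\<^sup>2)"
    and Y_mean: "\<And>i. s < i \<Longrightarrow> expectation (Y i) = 0"
    and B_past: "\<And>i. s \<le> i \<Longrightarrow> B i \<in> sets (past i)"
    and B_decseq: "decseq B"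
    and y: "y > 0" and n: "s \<le> n"
  shows "prob {\<omega> \<in> space M. \<exists>k\<in>{s<..n}. \<omega> \<in> B (k - 1) \<and> \<bar>\<Sum>i\<in>{s<..k}. Y i \<omega>\<bar> > y}
      \<le> (\<Sum>i\<in>{s..<n}. prob (B i) * expectation (\<lambda>\<omega>. (Y (Suc i) \<omega>)\<^sup>2)) / y\<^sup>2"
proof -
  define S where "S k \<omega> = (\<Sum>i\<in>{s<..k}. Y i \<omega>)" for k \<omega>
  define A where "A i = {\<omega> \<in> space M. \<omega> \<in> B i \<and> (\<forall>j\<in>{s<..i}. \<bar>S j \<omega>\<bar> \<le> y)}" for i
  define Z where "Z n \<omega> = (\<Sum>i\<in>{s..<n}. indicator (A i) \<omega> * Y (Suc i) \<omega>)" for n \<omega>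
  define C where "C n = {\<omega> \<in> space M. \<exists>k\<in>{s<..n}. \<omega> \<in> B (k - 1) \<and> \<bar>S k \<omega>\<bar> > y}" for n
  have S_Suc: "S (Suc k) \<omega> = S k \<omega> + Y (Suc k) \<omega>" if "s \<le> k" for k \<omega>
  proof -
    have "{s<..Suc k} = insert (Suc k) {s<..k}" using that by auto
    then show ?thesis by (simp add: S_def)
  qed
  have Z_Suc: "Z (Suc k) \<omega> = Z k \<omega> + indicator (A k) \<omega> * Y (Suc k) \<omega>" if "s \<le> k" for k \<omega>
    using that by (simp add: Z_def)
  have S_past: "S j \<in> borel_measurable (past i)" if "j \<le> i" for i j
    unfolding S_def using that by (intro borel_measurable_sum Y_past) auto
  have A_past: "A i \<in> sets (past i)" if "s \<le> i" for i
  proof -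
    have "{\<omega> \<in> space (past i). \<bar>S j \<omega>\<bar> \<le> y} \<in> sets (past i)" if "j \<in> {s<..i}" for j
    proof -
      have [measurable]: "S j \<in> borel_measurable (past i)" using that by (intro S_past) auto
      show ?thesis by measurable
    qed
    then have "{\<omega> \<in> space (past i). \<forall>j\<in>{s<..i}. \<bar>S j \<omega>\<bar> \<le> y} \<in> sets (past i)"
      by (intro sets.sets_Collect_finite_All) auto
    moreover have "A i = B i \<inter> {\<omega> \<in> space (past i). \<forall>j\<in>{s<..i}. \<bar>S j \<omega>\<bar> \<le> y}"
      by (auto simp: A_def)
    ultimately show ?thesis using B_past[OF that] by auto
  qed
  have B_mono: "B j \<subseteq> B i" if "i \<le> j" for i j
    using B_decseq that by (auto simp: decseq_def)
  \<comment> \<open>The stopped sum \<open>Z\<close> follows \<open>S\<close> up to the first exit and then stays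
    outside of the interval.\<close>
  have track: "(\<omega> \<in> A n \<longrightarrow> Z n \<omega> = S n \<omega>) \<and> (\<omega> \<in> C n \<longrightarrow> y < \<bar>Z n \<omega>\<bar>)"
    if "\<omega> \<in> space M" "s \<le> n" for n \<omega>
    using that(2)
  proof (induction n rule: dec_induct)
    case base
    show ?case by (simp add: Z_def S_def C_def)
  next
    case (step n)
    have A_n: "\<omega> \<in> A n" if "\<omega> \<in> A (Suc n)"
      using that B_mono[of n "Suc n"] by (auto simp: A_def)
    have "Z (Suc n) \<omega> = S (Suc n) \<omega>" if "\<omega> \<in> A (Suc n)"
      using A_n[OF that] step by (simp add: Z_Suc S_Suc)
    moreover have "y < \<bar>Z (Suc n) \<omega>\<bar>" if C: "\<omega> \<in> C (Suc n)"
    proof (cases "\<omega> \<in> C n")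
      case True
      then have "\<omega> \<notin> A n" by (force simp: C_def A_def not_le)
      then show ?thesis using True step by (simp add: Z_Suc)
    next
      case False
      obtain k where k: "s < k" "k \<le> Suc n" "\<omega> \<in> B (k - 1)" "y < \<bar>S k \<omega>\<bar>"
        using C by (auto simp: C_def)
      have "k = Suc n"
      proof (rule ccontr)
        assume "k \<noteq> Suc n"
        then have "\<omega> \<in> C n" using k that(1) \<open>\<omega> \<in> space M\<close> by (auto simp: C_def)
        with False show False ..
      qed
      then have "\<omega> \<in> B n" using k by simp
      have "\<bar>S j \<omega>\<bar> \<le> y" if "j \<in> {s<..n}" for j
      proof -
        have "\<omega> \<in> B (j - 1)" using B_mono[of "j - 1" n] that \<open>\<omega> \<in> B n\<close> by fastforce
        then have "y < \<bar>S j \<omega>\<bar> \<Longrightarrow> \<omega> \<in> C n"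
          using that \<open>\<omega> \<in> space M\<close> by (auto simp: C_def)
        then show ?thesis using False by linarith
      qed
      then have "\<omega> \<in> A n" using \<open>\<omega> \<in> B n\<close> \<open>\<omega> \<in> space M\<close> by (simp add: A_def)
      then show ?thesis using k \<open>k = Suc n\<close> step by (simp add: Z_Suc S_Suc)
    qed
    ultimately show ?case by blast
  qed
  have Y_int: "integrable M (Y i)" if "s < i" for i
    using that by (intro square_integrable_imp_integrable[OF past_measurable[OF Y_past] Y_sq]) auto
  have moment: "integrable M (\<lambda>\<omega>. (Z n \<omega>)\<^sup>2) \<and>
      expectation (\<lambda>\<omega>. (Z n \<omega>)\<^sup>2) \<le>
        (\<Sum>i\<in>{s..<n}. prob (B i) * expectation (\<lambda>\<omega>. (Y (Suc i) \<omega>)\<^sup>2))" if "s \<le> n" for n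
    using that
  proof (induction n rule: dec_induct)
    case base
    show ?case by (simp add: Z_def)
  next
    case (step n)
    define V where "V \<omega> = indicator (A n) \<omega> * S n \<omega>" for \<omega>
    have A_ev: "A n \<in> events" using A_past step sets_past by blast
    have V_past: "V \<in> borel_measurable (past n)"
      unfolding V_def using A_past[OF step(1)] S_past[of n n] by auto
    \<comment> \<open>The bound on \<open>S n\<close> over \<open>A n\<close> makes the mixed term integrable.\<close>
    have V_bound: "\<bar>V \<omega>\<bar> \<le> y" for \<omega>
      using y by (cases "n = s") (auto simp: V_def A_def S_def indicator_def)
    have V_int: "integrable M V"
      by (rule integrable_const_bound[of _ y])
        (use V_bound past_measurable[OF V_past] in auto)
    have ind_int: "integrable M (indicator (A n) :: 'a \<Rightarrow> real)"
      using A_ev by (intro integrable_real_indicator) (auto simp: emeasure_eq_measure)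
    have ind_past: "(indicator (A n) :: 'a \<Rightarrow> real) \<in> borel_measurable (past n)"
      using A_past[OF step(1)] by simp
    have Y2_future: "(\<lambda>\<omega>. (Y (Suc n) \<omega>)\<^sup>2) \<in> borel_measurable (future n)"
      using Y_future[OF step(1)] by simp
    have Ys: "integrable M (Y (Suc n))" "integrable M (\<lambda>\<omega>. (Y (Suc n) \<omega>)\<^sup>2)"
      using step(1) by (auto intro!: Y_int Y_sq)
    note cross = integrable_past_times_future[OF V_past Y_future V_int Ys(1)]
      expectation_past_times_future[OF V_past Y_future V_int Ys(1)]
    note diag = integrable_past_times_future[OF ind_past Y2_future ind_int Ys(2)]
      expectation_past_times_future[OF ind_past Y2_future ind_int Ys(2)]
    have expand: "(Z (Suc n) \<omega>)\<^sup>2 = (Z n \<omega>)\<^sup>2 + 2 * (V \<omega> * Y (Suc n) \<omega>)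
         + indicator (A n) \<omega> * (Y (Suc n) \<omega>)\<^sup>2" if "\<omega> \<in> space M" for \<omega>
      using track[OF that step(1)]
      by (cases "\<omega> \<in> A n") (auto simp: Z_Suc[OF step(1)] V_def power2_eq_square algebra_simps)
    have int: "integrable M (\<lambda>\<omega>. (Z n \<omega>)\<^sup>2 + 2 * (V \<omega> * Y (Suc n) \<omega>)
         + indicator (A n) \<omega> * (Y (Suc n) \<omega>)\<^sup>2)"
      using cross(1) diag(1) step by auto
    then have int': "integrable M (\<lambda>\<omega>. (Z (Suc n) \<omega>)\<^sup>2)"
      by (subst Bochner_Integration.integrable_cong[OF refl expand]) auto
    have "expectation (\<lambda>\<omega>. (Z (Suc n) \<omega>)\<^sup>2) = expectation (\<lambda>\<omega>. (Z n \<omega>)\<^sup>2 + 2 * (V \<omega> * Y (Suc n) \<omega>)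
         + indicator (A n) \<omega> * (Y (Suc n) \<omega>)\<^sup>2)"
      by (intro Bochner_Integration.integral_cong refl expand)
    also have "\<dots> = expectation (\<lambda>\<omega>. (Z n \<omega>)\<^sup>2) + prob (A n) * expectation (\<lambda>\<omega>. (Y (Suc n) \<omega>)\<^sup>2)"
      using cross diag step A_ev Y_mean[of "Suc n"] by simp
    also have "\<dots> \<le> (\<Sum>i\<in>{s..<n}. prob (B i) * expectation (\<lambda>\<omega>. (Y (Suc i) \<omega>)\<^sup>2))
        + prob (B n) * expectation (\<lambda>\<omega>. (Y (Suc n) \<omega>)\<^sup>2)"
    proof (intro add_mono mult_right_mono)
      show "prob (A n) \<le> prob (B n)"
        using B_past[OF step(1)] sets_past[of n] by (intro finite_measure_mono) (auto simp: A_def)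
    qed (use step in auto)
    finally show ?case using int' step(1) by simp
  qed
  have C_ev: "{\<omega> \<in> space M. y < \<bar>Z n \<omega>\<bar>} \<in> events"
  proof -
    have "Z n \<in> borel_measurable M"
      unfolding Z_def
    proof (intro borel_measurable_sum borel_measurable_times)
      fix i assume "i \<in> {s..<n}"
      then have "s < Suc i" "A i \<in> events" using A_past[of i] sets_past[of i] by auto
      then show "Y (Suc i) \<in> borel_measurable M" "indicator (A i) \<in> borel_measurable M"
        by (auto intro: past_measurable[OF Y_past])
    qed
    then show ?thesis by measurable
  qed
  have Zn: "integrable M (\<lambda>\<omega>. (Z n \<omega>)\<^sup>2)" using moment[OF n] by simp
  have "prob (C n) \<le> prob {\<omega> \<in> space M. (Z n \<omega>)\<^sup>2 \<ge> y\<^sup>2}"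
  proof (rule finite_measure_mono)
    show "C n \<subseteq> {\<omega> \<in> space M. (Z n \<omega>)\<^sup>2 \<ge> y\<^sup>2}"
    proof
      fix \<omega> assume "\<omega> \<in> C n"
      then have "\<omega> \<in> space M" "y < \<bar>Z n \<omega>\<bar>" using track[OF _ n, of \<omega>] by (auto simp: C_def)
      moreover from this(2) have "y\<^sup>2 \<le> \<bar>Z n \<omega>\<bar>\<^sup>2" using y by (intro power_mono) auto
      ultimately show "\<omega> \<in> {\<omega> \<in> space M. (Z n \<omega>)\<^sup>2 \<ge> y\<^sup>2}" by simp
    qed
    show "{\<omega> \<in> space M. (Z n \<omega>)\<^sup>2 \<ge> y\<^sup>2} \<in> events"
      using borel_measurable_integrable[OF Zn] by measurable
  qed
  also have "\<dots> \<le> expectation (\<lambda>\<omega>. (Z n \<omega>)\<^sup>2) / y\<^sup>2"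
    using integral_Markov_inequality_measure[OF Zn, of "{}" "y\<^sup>2"] y by auto
  also have "\<dots> \<le> (\<Sum>i\<in>{s..<n}. prob (B i) * expectation (\<lambda>\<omega>. (Y (Suc i) \<omega>)\<^sup>2)) / y\<^sup>2"
    using moment[OF n] by (intro divide_right_mono) auto
  finally show ?thesis unfolding C_def S_def .
qed

end

section \<open>Escapes through many levels\<close>

context past_future
begin

definition escape :: "(nat \<Rightarrow> 'a \<Rightarrow> real) \<Rightarrow> (nat \<Rightarrow> 'a set) \<Rightarrow> nat \<Rightarrow> real \<Rightarrow> 'a set" where
  "escape Y B n y =
     {\<omega> \<in> space M. \<exists>k\<in>{0<..n}. \<omega> \<in> B (k - 1) \<and> \<bar>\<Sum>i\<in>{0<..k}. Y i \<omega>\<bar> > y}"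

lemma sets_escape:
  assumes Y: "\<And>j. 0 < j \<Longrightarrow> Y j \<in> borel_measurable M" and B: "\<And>i. B i \<in> events"
  shows "escape Y B n y \<in> events"
proof -
  have "{\<omega> \<in> space M. \<omega> \<in> B (k - 1) \<and> \<bar>\<Sum>i\<in>{0<..k}. Y i \<omega>\<bar> > y} \<in> events" for k
  proof -
    have [measurable]: "(\<lambda>\<omega>. \<Sum>i\<in>{0<..k}. Y i \<omega>) \<in> borel_measurable M"
      using Y by (intro borel_measurable_sum) auto
    have [measurable]: "B (k - 1) \<in> events" by (rule B)
    show ?thesis by measurable
  qed
  then show ?thesis
    unfolding escape_def by (intro sets.sets_Collect_finite_Ex) auto
qed

text \<open>A sum with steps bounded by \<open>h\<close> is within \<open>y + h\<close> when it first leaves \<open>[-y, y]\<close>. To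
pass \<open>y + h + y'\<close> it must afterwards move by more than \<open>y'\<close>, and it must still be alive
at the time \<open>k\<close> of the first exit. That exit, together with survival of \<open>k\<close>, belongs to
the past of \<open>k\<close>; the later move belongs to the future, and Kolmogorov's inequality
without any death bounds its probability by \<open>n v / y'\<^sup>2\<close>.\<close>

lemma prob_escape_next_level:
  fixes Y :: "nat \<Rightarrow> 'a \<Rightarrow> real"
  assumes Y_past: "\<And>i j. 0 < j \<Longrightarrow> j \<le> i \<Longrightarrow> Y j \<in> borel_measurable (past i)"
    and Y_future: "\<And>i j. i < j \<Longrightarrow> Y j \<in> borel_measurable (future i)"
    and Y_bound: "\<And>i \<omega>. 0 < i \<Longrightarrow> \<bar>Y i \<omega>\<bar> \<le> h"
    and Y_mean: "\<And>i. 0 < i \<Longrightarrow> expectation (Y i) = 0"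
    and Y_var: "\<And>i. 0 < i \<Longrightarrow> expectation (\<lambda>\<omega>. (Y i \<omega>)\<^sup>2) \<le> v"
    and B_past: "\<And>i. B i \<in> sets (past i)"
    and B_decseq: "decseq B"
    and y: "y \<ge> 0" and y': "y' > 0"
  shows "prob (escape Y B n (y + h + y')) \<le> prob (escape Y B n y) * (n * v / y'\<^sup>2)"
proof -
  define S where "S k \<omega> = (\<Sum>i\<in>{0<..k}. Y i \<omega>)" for k \<omega>
  define D where "D k = {\<omega> \<in> space M. \<omega> \<in> B k \<and> \<bar>S k \<omega>\<bar> > y \<and> (\<forall>j\<in>{0<..<k}. \<bar>S j \<omega>\<bar> \<le> y)}" for k
  define E where "E k = {\<omega> \<in> space M. \<exists>j\<in>{k<..n}. \<bar>\<Sum>i\<in>{k<..j}. Y i \<omega>\<bar> > y'}" for k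
  have Y_meas: "Y j \<in> borel_measurable M" if "0 < j" for j
    using that by (intro past_measurable[OF Y_past]) auto
  have B_ev: "B i \<in> events" for i using B_past sets_past by blast
  have Y_sq: "integrable M (\<lambda>\<omega>. (Y i \<omega>)\<^sup>2)" if "0 < i" for i
  proof (rule integrable_const_bound[of _ "h\<^sup>2"])
    show "AE \<omega> in M. norm ((Y i \<omega>)\<^sup>2) \<le> h\<^sup>2"
      using power_mono[OF Y_bound[OF that], of _ 2] by auto
    show "(\<lambda>\<omega>. (Y i \<omega>)\<^sup>2) \<in> borel_measurable M" using Y_meas[OF that] by simp
  qed
  have v: "0 \<le> v"
  proof -
    have "0 \<le> expectation (\<lambda>\<omega>. (Y 1 \<omega>)\<^sup>2)" by simp
    also have "\<dots> \<le> v" by (rule Y_var) simp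
    finally show ?thesis .
  qed
  have S_past: "S j \<in> borel_measurable (past i)" if "j \<le> i" for i j
    unfolding S_def using that by (intro borel_measurable_sum Y_past) auto
  have D_past: "D k \<in> sets (past k)" for k
  proof -
    have S_small: "{\<omega> \<in> space (past k). \<bar>S j \<omega>\<bar> \<le> y} \<in> sets (past k)" if "j \<le> k" for j
    proof -
      have [measurable]: "S j \<in> borel_measurable (past k)" using that by (intro S_past) auto
      show ?thesis by measurable
    qed
    have 1: "{\<omega> \<in> space (past k). \<forall>j\<in>{0<..<k}. \<bar>S j \<omega>\<bar> \<le> y} \<in> sets (past k)"
      using S_small by (intro sets.sets_Collect_finite_All) auto
    have "space (past k) - {\<omega> \<in> space (past k). \<bar>S k \<omega>\<bar> \<le> y} \<in> sets (past k)"
      using S_small[of k] by blast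
    moreover have "D k = B k \<inter> (space (past k) - {\<omega> \<in> space (past k). \<bar>S k \<omega>\<bar> \<le> y})
        \<inter> {\<omega> \<in> space (past k). \<forall>j\<in>{0<..<k}. \<bar>S j \<omega>\<bar> \<le> y}"
      by (auto simp: D_def)
    ultimately show ?thesis using 1 B_past[of k] by auto
  qed
  have E_future: "E k \<in> sets (future k)" for k
  proof -
    have "{\<omega> \<in> space (future k). \<bar>\<Sum>i\<in>{k<..j}. Y i \<omega>\<bar> > y'} \<in> sets (future k)" for j
    proof -
      have [measurable]: "(\<lambda>\<omega>. \<Sum>i\<in>{k<..j}. Y i \<omega>) \<in> borel_measurable (future k)"
        using Y_future by (intro borel_measurable_sum) auto
      show ?thesis by measurable
    qed
    then have "{\<omega> \<in> space (future k). \<exists>j\<in>{k<..n}. \<bar>\<Sum>i\<in>{k<..j}. Y i \<omega>\<bar> > y'} \<in> sets (future k)"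
      by (intro sets.sets_Collect_finite_Ex) auto
    then show ?thesis by (simp add: E_def)
  qed
  have E_prob: "prob (E k) \<le> n * v / y'\<^sup>2" if "k \<le> n" for k
  proof -
    have "prob {\<omega> \<in> space M. \<exists>j\<in>{k<..n}. \<omega> \<in> space M \<and> \<bar>\<Sum>i\<in>{k<..j}. Y i \<omega>\<bar> > y'}
        \<le> (\<Sum>i\<in>{k..<n}. prob (space M) * expectation (\<lambda>\<omega>. (Y (Suc i) \<omega>)\<^sup>2)) / y'\<^sup>2"
    proof (rule kolmogorov_while_alive[OF Y_past Y_future _ _ _ _ y' that])
      show "space M \<in> sets (past i)" for i
        using sets.top[of "past i"] by simp
      show "integrable M (\<lambda>\<omega>. (Y i \<omega>)\<^sup>2)" "expectation (Y i) = 0" if "k < i" for i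
        using that by (auto intro: Y_sq Y_mean)
    qed (auto simp: decseq_def)
    also have "\<dots> \<le> (\<Sum>i\<in>{k..<n}. v) / y'\<^sup>2"
      using Y_var by (intro divide_right_mono sum_mono) (auto simp: prob_space)
    also have "\<dots> \<le> n * v / y'\<^sup>2"
      using v by (intro divide_right_mono) (auto intro!: mult_right_mono)
    also have "{\<omega> \<in> space M. \<exists>j\<in>{k<..n}. \<omega> \<in> space M \<and> \<bar>\<Sum>i\<in>{k<..j}. Y i \<omega>\<bar> > y'} = E k"
      by (auto simp: E_def)
    finally show ?thesis .
  qed
  have D_ev: "D k \<in> events" and E_ev: "E k \<in> events" for k
    using D_past sets_past E_future sets_future by blast+
  have B_mono: "B j \<subseteq> B i" if "i \<le> j" for i j
    using B_decseq that by (auto simp: decseq_def)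
  have S_split: "S j \<omega> = S k \<omega> + (\<Sum>i\<in>{k<..j}. Y i \<omega>)" if "k \<le> j" for j k \<omega>
  proof -
    have "{0<..j} = {0<..k} \<union> {k<..j}" using that by auto
    then show ?thesis by (simp add: S_def sum.union_disjoint)
  qed
  have cover: "escape Y B n (y + h + y') \<subseteq> (\<Union>k\<in>{0<..n}. D k \<inter> E k)"
  proof
    fix \<omega> assume "\<omega> \<in> escape Y B n (y + h + y')"
    then obtain j where \<omega>: "\<omega> \<in> space M" and j: "0 < j" "j \<le> n" "\<omega> \<in> B (j - 1)" "\<bar>S j \<omega>\<bar> > y + h + y'"
      by (auto simp: escape_def S_def)
    have "\<bar>Y 1 \<omega>\<bar> \<le> h" by (rule Y_bound) simp
    then have "0 \<le> h" by linarith
    define k where "k = (LEAST k. 0 < k \<and> \<bar>S k \<omega>\<bar> > y)"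
    have "0 < j \<and> \<bar>S j \<omega>\<bar> > y" using j y' \<open>0 \<le> h\<close> by simp
    then have k: "0 < k \<and> \<bar>S k \<omega>\<bar> > y" and "k \<le> j"
      unfolding k_def by (rule LeastI, rule Least_le)
    have below: "\<bar>S i \<omega>\<bar> \<le> y" if "0 < i" "i < k" for i
      using not_less_Least[of i "\<lambda>k. 0 < k \<and> \<bar>S k \<omega>\<bar> > y"] that unfolding k_def by auto
    have "{k - 1<..k} = {k}" using k by auto
    then have "S k \<omega> = S (k - 1) \<omega> + Y k \<omega>" using S_split[of "k - 1" k \<omega>] by simp
    moreover have "\<bar>S (k - 1) \<omega>\<bar> \<le> y"
      using below[of "k - 1"] y k by (cases "k = 1") (auto simp: S_def)
    ultimately have Sk: "\<bar>S k \<omega>\<bar> \<le> y + h" using Y_bound[of k \<omega>] k by linarith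
    \<comment> \<open>The first exit cannot overshoot beyond \<open>y + h\<close>, so it is not the step \<open>j\<close>
      itself, and the process is still alive after it.\<close>
    then have "k < j" using j y' \<open>k \<le> j\<close> by (cases "k = j") auto
    then have "\<omega> \<in> B k" using j B_mono[of k "j - 1"] by fastforce
    then have "\<omega> \<in> D k" using \<omega> k below by (auto simp: D_def)
    moreover have "\<omega> \<in> E k"
    proof -
      have "\<bar>\<Sum>i\<in>{k<..j}. Y i \<omega>\<bar> > y'" using S_split[of k j \<omega>] \<open>k < j\<close> j Sk by linarith
      then show ?thesis using \<omega> j \<open>k < j\<close> by (auto simp: E_def)
    qed
    ultimately show "\<omega> \<in> (\<Union>k\<in>{0<..n}. D k \<inter> E k)"
      using k \<open>k < j\<close> j by auto
  qed
  have D_once: "i \<ge> j" if "0 < i" "\<omega> \<in> D i" "\<omega> \<in> D j" for i j \<omega>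
  proof (rule ccontr)
    assume "\<not> j \<le> i"
    then have "\<bar>S i \<omega>\<bar> \<le> y" using that by (simp add: D_def)
    then show False using that by (simp add: D_def)
  qed
  have "disjoint_family_on D {0<..n}"
    unfolding disjoint_family_on_def
  proof (intro ballI impI)
    fix i j assume ij: "i \<in> {0<..n}" "j \<in> {0<..n}" "i \<noteq> j"
    have False if "\<omega> \<in> D i" "\<omega> \<in> D j" for \<omega>
      using D_once[of i \<omega> j] D_once[of j \<omega> i] that ij by simp
    then show "D i \<inter> D j = {}" by blast
  qed
  have "prob (escape Y B n (y + h + y')) \<le> prob (\<Union>k\<in>{0<..n}. D k \<inter> E k)"
    using cover D_ev E_ev by (intro finite_measure_mono) auto
  also have "\<dots> \<le> (\<Sum>k\<in>{0<..n}. prob (D k \<inter> E k))"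
    using D_ev E_ev by (intro finite_measure_subadditive_finite) auto
  also have "\<dots> = (\<Sum>k\<in>{0<..n}. prob (D k) * prob (E k))"
    by (simp add: past_indep_future[OF D_past E_future])
  also have "\<dots> \<le> (\<Sum>k\<in>{0<..n}. prob (D k) * (n * v / y'\<^sup>2))"
    using E_prob by (intro sum_mono mult_left_mono) auto
  also have "\<dots> = (\<Sum>k\<in>{0<..n}. prob (D k)) * (n * v / y'\<^sup>2)"
    by (rule sum_distrib_right[symmetric])
  also have "\<dots> = prob (\<Union>k\<in>{0<..n}. D k) * (n * v / y'\<^sup>2)"
    using D_ev \<open>disjoint_family_on D {0<..n}\<close>
    by (subst finite_measure_finite_Union) auto
  also have "\<dots> \<le> prob (escape Y B n y) * (n * v / y'\<^sup>2)"
  proof (intro mult_right_mono finite_measure_mono)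
    show "(\<Union>k\<in>{0<..n}. D k) \<subseteq> escape Y B n y"
    proof
      fix \<omega> assume "\<omega> \<in> (\<Union>k\<in>{0<..n}. D k)"
      then obtain k where k: "k \<in> {0<..n}" "\<omega> \<in> D k" by blast
      then have "\<omega> \<in> B (k - 1)" using B_mono[of "k - 1" k] by (auto simp: D_def)
      then show "\<omega> \<in> escape Y B n y" using k by (auto simp: escape_def D_def S_def)
    qed
    show "escape Y B n y \<in> events" by (intro sets_escape Y_meas B_ev)
  qed (use v in auto)
  finally show ?thesis .
qed

text \<open>The first level is crossed at the price of Kolmogorov's inequality with the survival
probabilities; every further level, \<open>2 h\<close> apart, contributes one more factor
\<open>n v / h\<^sup>2\<close>. Any power of that factor is gained by making the steps small compared
with the distance to travel.\<close>

lemma prob_escape_power: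
  fixes Y :: "nat \<Rightarrow> 'a \<Rightarrow> real"
  assumes Y_past: "\<And>i j. 0 < j \<Longrightarrow> j \<le> i \<Longrightarrow> Y j \<in> borel_measurable (past i)"
    and Y_future: "\<And>i j. i < j \<Longrightarrow> Y j \<in> borel_measurable (future i)"
    and Y_bound: "\<And>i \<omega>. 0 < i \<Longrightarrow> \<bar>Y i \<omega>\<bar> \<le> h"
    and Y_mean: "\<And>i. 0 < i \<Longrightarrow> expectation (Y i) = 0"
    and Y_var: "\<And>i. 0 < i \<Longrightarrow> expectation (\<lambda>\<omega>. (Y i \<omega>)\<^sup>2) \<le> v"
    and B_past: "\<And>i. B i \<in> sets (past i)"
    and B_decseq: "decseq B"
    and h: "h > 0"
  shows "prob (escape Y B n ((2 * real m + 1) * h))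
    \<le> (\<Sum>i<n. prob (B i)) * v / h\<^sup>2 * (n * v / h\<^sup>2) ^ m"
proof (induction m)
  case 0
  have Y_sq: "integrable M (\<lambda>\<omega>. (Y i \<omega>)\<^sup>2)" if "0 < i" for i
  proof (rule integrable_const_bound[of _ "h\<^sup>2"])
    show "AE \<omega> in M. norm ((Y i \<omega>)\<^sup>2) \<le> h\<^sup>2"
      using power_mono[OF Y_bound[OF that], of _ 2] by auto
    have "Y i \<in> borel_measurable M" using that by (intro past_measurable[OF Y_past]) auto
    then show "(\<lambda>\<omega>. (Y i \<omega>)\<^sup>2) \<in> borel_measurable M" by simp
  qed
  have "prob (escape Y B n h)
      \<le> (\<Sum>i\<in>{0..<n}. prob (B i) * expectation (\<lambda>\<omega>. (Y (Suc i) \<omega>)\<^sup>2)) / h\<^sup>2"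
    unfolding escape_def
    by (rule kolmogorov_while_alive[OF Y_past Y_future Y_sq Y_mean B_past B_decseq h]) auto
  also have "\<dots> \<le> (\<Sum>i\<in>{0..<n}. prob (B i) * v) / h\<^sup>2"
    using Y_var by (intro divide_right_mono sum_mono mult_left_mono) auto
  finally show ?case by (simp add: sum_distrib_right lessThan_atLeast0)
next
  case (Suc m)
  have v: "0 \<le> v"
  proof -
    have "0 \<le> expectation (\<lambda>\<omega>. (Y 1 \<omega>)\<^sup>2)" by simp
    also have "\<dots> \<le> v" by (rule Y_var) simp
    finally show ?thesis .
  qed
  have "prob (escape Y B n ((2 * real (Suc m) + 1) * h))
      = prob (escape Y B n ((2 * real m + 1) * h + h + h))"
    by (simp add: algebra_simps)
  also have "\<dots> \<le> prob (escape Y B n ((2 * real m + 1) * h)) * (n * v / h\<^sup>2)"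
    using h by (intro prob_escape_next_level[OF Y_past Y_future Y_bound Y_mean Y_var B_past B_decseq])
      auto
  also have "\<dots> \<le> (\<Sum>i<n. prob (B i)) * v / h\<^sup>2 * (n * v / h\<^sup>2) ^ m * (n * v / h\<^sup>2)"
    using v by (intro mult_right_mono Suc.IH) auto
  finally show ?case by (simp add: mult_ac)
qed

end

section \<open>Tails of dominated variation\<close>

text \<open>Comparing \<open>F\<close> at \<open>y\<close>, \<open>y / r\<close>, \<open>y / r\<^sup>2\<close>, and so on, up to \<open>x\<close> loses a factor 2 at each
of about \<open>log (x / y)\<close> comparisons, hence a power of \<open>x / y\<close> in total.\<close>

lemma dominated_variation_power:
  fixes F :: "real \<Rightarrow> real"
  assumes F_nonneg: "\<And>x. 0 \<le> F x" and F_anti: "\<And>x y. x \<le> y \<Longrightarrow> F y \<le> F x"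
    and r: "0 < r" "r < 1" and x0: "0 < x0" and dom: "\<And>x. x0 \<le> x \<Longrightarrow> F (r * x) \<le> 2 * F x"
  shows "\<exists>\<gamma>. \<forall>y x. x0 \<le> y \<longrightarrow> y \<le> x \<longrightarrow> F y \<le> 2 * (x / y) ^ \<gamma> * F x"
proof -
  define q where "q = 1 / r"
  have q: "1 < q" using r by (simp add: q_def)
  obtain \<gamma> where \<gamma>: "2 < q ^ \<gamma>" using real_arch_pow[OF q] by blast
  have step: "F x \<le> 2 * F (q * x)" if "x0 \<le> x" for x
  proof -
    have "x0 \<le> q * x" using that x0 q mult_right_mono[of 1 q x] by linarith
    from dom[OF this] show ?thesis using r by (simp add: q_def)
  qed
  have iterate: "F y \<le> 2 ^ k * F (q ^ k * y)" if "x0 \<le> y" for k y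
  proof (induction k)
    case (Suc k)
    have "x0 \<le> q ^ k * y"
      using that x0 q mult_right_mono[of 1 "q ^ k" y] one_le_power[of q k] by linarith
    then have "2 ^ k * F (q ^ k * y) \<le> 2 ^ k * (2 * F (q * (q ^ k * y)))"
      by (intro mult_left_mono step) auto
    also have "\<dots> = 2 ^ Suc k * F (q ^ Suc k * y)" by (simp add: mult.assoc)
    finally show ?case using Suc by linarith
  qed simp
  have "F y \<le> 2 * (x / y) ^ \<gamma> * F x" if "x0 \<le> y" "y \<le> x" for x y
  proof -
    have y: "0 < y" using that x0 by simp
    have ex: "\<exists>k. x \<le> q ^ k * y"
    proof -
      obtain k where "x / y < q ^ k" using real_arch_pow[OF q] by blast
      then show ?thesis using y by (auto simp: field_simps intro!: exI[of _ k])
    qed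
    define k where "k = (LEAST k. x \<le> q ^ k * y)"
    have k: "x \<le> q ^ k * y" unfolding k_def using ex by (rule LeastI_ex)
    have xy: "1 \<le> (x / y) ^ \<gamma>" using that y by (intro one_le_power) simp
    show ?thesis
    proof (cases k)
      case 0
      then have "F y \<le> 1 * F x" using F_anti[of x y] k by simp
      also have "\<dots> \<le> (2 * (x / y) ^ \<gamma>) * F x"
        using xy by (intro mult_right_mono F_nonneg) auto
      finally show ?thesis .
    next
      case (Suc j)
      then have "\<not> x \<le> q ^ j * y" using not_less_Least[of j "\<lambda>k. x \<le> q ^ k * y"] by (simp add: k_def)
      then have j: "q ^ j \<le> x / y" using y by (simp add: field_simps)
      have "(2::real) ^ j \<le> (q ^ \<gamma>) ^ j" using \<gamma> by (intro power_mono) auto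
      also have "\<dots> = (q ^ j) ^ \<gamma>" by (simp add: power_mult[symmetric] mult.commute)
      also have "\<dots> \<le> (x / y) ^ \<gamma>" using j q by (intro power_mono) auto
      finally have "(2::real) ^ k \<le> 2 * (x / y) ^ \<gamma>" using Suc by simp
      have "F y \<le> 2 ^ k * F (q ^ k * y)" using iterate that by blast
      also have "\<dots> \<le> 2 ^ k * F x" using F_anti[OF k] by simp
      also have "\<dots> \<le> (2 * (x / y) ^ \<gamma>) * F x"
        using \<open>2 ^ k \<le> 2 * (x / y) ^ \<gamma>\<close> by (intro mult_right_mono F_nonneg)
      finally show ?thesis .
    qed
  qed
  then show ?thesis by blast
qed

text \<open>The analytic content of the hypothesis on the jumps. In the application \<open>F x\<close> is the tail
of \<open>\<tau>\<close>, \<open>G x\<close> is the mean of \<open>min \<tau> x\<close>, \<open>p\<close> is the tail of \<open>\<bar>\<xi>\<bar>\<close>, \<open>m\<close> is the mean of \<open>\<bar>\<xi>\<bar>\<close>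
and \<open>v x\<close> is the mean of \<open>min (\<xi>\<^sup>2) (x\<^sup>2)\<close> divided by \<open>x\<close>. The assumption \<open>G_star\<close> is what
concavity of \<open>G\<close> with \<open>G 0 = 0\<close> gives; \<open>v_split\<close> splits \<open>\<xi>\<^sup>2\<close> at the level \<open>z\<close>.\<close>

locale tail_comparison =
  fixes F G p v :: "real \<Rightarrow> real" and m :: real
  assumes F_pos: "\<And>x. 0 < F x"
    and F_anti: "\<And>x y. x \<le> y \<Longrightarrow> F y \<le> F x"
    and F_dominated: "\<exists>r>0. r < 1 \<and> (\<forall>\<^sub>F x in at_top. F (r * x) \<le> 2 * F x)"
    and G_ge: "\<And>x. 0 < x \<Longrightarrow> x * F x \<le> G x" and G_le: "\<And>x. 0 < x \<Longrightarrow> G x \<le> x"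
    and G_star: "\<And>z x. 0 < z \<Longrightarrow> z \<le> x \<Longrightarrow> z / x * G x \<le> G z"
    and p_small: "p \<in> o(\<lambda>x. F x / G x)"
    and v_nonneg: "\<And>x. 0 < x \<Longrightarrow> 0 \<le> v x"
    and v_split: "\<And>z x. 0 < z \<Longrightarrow> z \<le> x \<Longrightarrow> v x \<le> z / x * m + x * p z"
    and v_tendsto: "(v \<longlongrightarrow> 0) at_top"
begin

lemma G_pos: "0 < G x" if "0 < x"
  using G_ge[OF that] F_pos[of x] that by (smt (verit) mult_pos_pos)

lemma F_regular: "\<exists>\<gamma> x0. 0 < x0 \<and> (\<forall>y x. x0 \<le> y \<longrightarrow> y \<le> x \<longrightarrow> F y \<le> 2 * (x / y) ^ \<gamma> * F x)"
proof -
  obtain r where r: "0 < r" "r < 1" and "\<forall>\<^sub>F x in at_top. F (r * x) \<le> 2 * F x"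
    using F_dominated by blast
  from eventually_gt_at_top[of 0] this(3) have "\<forall>\<^sub>F x in at_top. 0 < x \<and> F (r * x) \<le> 2 * F x"
    by eventually_elim simp
  then obtain x0 where x0: "\<And>x. x0 \<le> x \<Longrightarrow> 0 < x \<and> F (r * x) \<le> 2 * F x"
    by (auto simp: eventually_at_top_linorder)
  have "0 < x0" using x0[of x0] by simp
  moreover have "\<exists>\<gamma>. \<forall>y x. x0 \<le> y \<longrightarrow> y \<le> x \<longrightarrow> F y \<le> 2 * (x / y) ^ \<gamma> * F x"
    using dominated_variation_power[of F r x0] F_pos F_anti r x0 \<open>0 < x0\<close>
    by (simp add: less_imp_le)
  ultimately show ?thesis by blast
qed

lemma F_over_G_rescale:
  assumes \<beta>: "0 < \<beta>" "\<beta> \<le> 1"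
  shows "(\<lambda>x. F (\<beta> * x) / G (\<beta> * x)) \<in> O(\<lambda>x. F x / G x)"
proof -
  obtain \<gamma> x0 where x0: "0 < x0" and
    reg: "\<And>y x. x0 \<le> y \<Longrightarrow> y \<le> x \<Longrightarrow> F y \<le> 2 * (x / y) ^ \<gamma> * F x"
    using F_regular by blast
  show ?thesis
  proof (rule bigoI)
    show "\<forall>\<^sub>F x in at_top. norm (F (\<beta> * x) / G (\<beta> * x)) \<le> 2 / \<beta> ^ Suc \<gamma> * norm (F x / G x)"
      using eventually_ge_at_top[of "x0 / \<beta>"]
    proof eventually_elim
      case (elim x)
      then have x: "x0 \<le> \<beta> * x" using \<beta> by (simp add: field_simps)
      have "0 < x" using x0 elim \<beta> by (smt (verit) divide_pos_pos)
      have le: "\<beta> * x \<le> x" using \<beta> \<open>0 < x\<close> by simp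
      have "F (\<beta> * x) \<le> 2 / \<beta> ^ \<gamma> * F x"
        using reg[OF x le] \<open>0 < x\<close> \<beta> by (simp add: power_divide field_simps)
      moreover have "\<beta> * G x \<le> G (\<beta> * x)"
        using G_star[of "\<beta> * x" x] le \<open>0 < x\<close> \<beta> by simp
      ultimately have "F (\<beta> * x) / G (\<beta> * x) \<le> (2 / \<beta> ^ \<gamma> * F x) / (\<beta> * G x)"
        using \<beta> G_pos[OF \<open>0 < x\<close>] F_pos by (intro frac_le) (auto simp: less_imp_le)
      also have "\<dots> = 2 / \<beta> ^ Suc \<gamma> * (F x / G x)" by simp
      finally show ?case
        using F_pos[of x] F_pos[of "\<beta> * x"] G_pos[of x] G_pos[of "\<beta> * x"] \<open>0 < x\<close> \<beta> by simp
    qed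
  qed
qed

text \<open>On average \<open>G x\<close> steps are taken up to time \<open>x\<close>, so this is the order of the probability
that one of them exceeds \<open>\<beta> * x\<close>.\<close>

lemma big_jumps_negligible:
  assumes \<beta>: "0 < \<beta>" "\<beta> \<le> 1"
  shows "(\<lambda>x. G x * p (\<beta> * x)) \<in> o(F)"
proof -
  have "filterlim (\<lambda>x. \<beta> * x) at_top at_top"
    using \<beta> by (intro filterlim_tendsto_pos_mult_at_top[OF tendsto_const] filterlim_ident) auto
  then have "(\<lambda>x. p (\<beta> * x)) \<in> o(\<lambda>x. F (\<beta> * x) / G (\<beta> * x))"
    by (rule landau_o.small.compose[OF p_small])
  also have "(\<lambda>x. F (\<beta> * x) / G (\<beta> * x)) \<in> O(\<lambda>x. F x / G x)"
    by (rule F_over_G_rescale[OF \<beta>])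
  finally have "(\<lambda>x. G x * p (\<beta> * x)) \<in> o(\<lambda>x. G x * (F x / G x))"
    by (rule landau_o.small.mult_left)
  also have "o(\<lambda>x. G x * (F x / G x)) = o(F)"
  proof (rule landau_o.small.cong)
    show "\<forall>\<^sub>F x in at_top. G x * (F x / G x) = F x"
      using eventually_gt_at_top[of 0] by eventually_elim (use G_pos in force)
  qed
  finally show ?thesis .
qed

text \<open>Put \<open>r = x F(x) / G(x)\<close>. By the hypothesis on \<open>p\<close>, dominated variation of \<open>F\<close> and
concavity of \<open>G\<close>, \<open>x p(s x) \<le> 2 r / s^(\<gamma> + 1)\<close>, so splitting at \<open>z = s x\<close> gives
\<open>v x \<le> m s + 2 r / s^(\<gamma> + 1)\<close>. The two terms balance at \<open>s = r^(1 / (\<gamma> + 2))\<close>, where the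
bound is a multiple of \<open>s\<close>; the power \<open>k = \<gamma> + 2\<close> then returns \<open>r\<close>.\<close>

lemma moment_power_bound: "\<exists>k. (\<lambda>x. v x ^ k) \<in> O(\<lambda>x. x * F x / G x)"
proof -
  obtain \<gamma> x0 where x0: "0 < x0" and
    reg: "\<And>y x. x0 \<le> y \<Longrightarrow> y \<le> x \<Longrightarrow> F y \<le> 2 * (x / y) ^ \<gamma> * F x"
    using F_regular by blast
  have "\<forall>\<^sub>F x in at_top. p x \<le> F x / G x"
    using landau_o.smallD[OF p_small zero_less_one] eventually_gt_at_top[of 0]
  proof eventually_elim
    case (elim x)
    then show ?case using F_pos[of x] G_pos[of x] by simp
  qed
  then obtain x1 where x1: "\<And>x. x1 \<le> x \<Longrightarrow> p x \<le> F x / G x"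
    by (auto simp: eventually_at_top_linorder)
  define k where "k = \<gamma> + 2"
  define X where "X = max x0 x1"
  have X: "0 < X" "x0 \<le> X" "x1 \<le> X" using x0 by (auto simp: X_def)
  have "(\<lambda>x. v x ^ k) \<in> O(\<lambda>x. x * F x / G x)"
  proof (rule bigoI)
    show "\<forall>\<^sub>F x in at_top. norm (v x ^ k) \<le> (m + 2) ^ k * norm (x * F x / G x)"
      using eventually_ge_at_top[of X] eventually_ge_at_top[of "2 * X / F X"]
    proof eventually_elim
      case (elim x)
      have x: "0 < x" using elim X by simp
      define r where "r = x * F x / G x"
      have r: "0 < r" "r \<le> 1"
        using G_ge[OF x] G_pos[OF x] F_pos[of x] x by (auto simp: r_def)
      define s where "s = root k r"
      have s: "0 < s" "s ^ k = r" "s \<le> 1"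
        using r real_root_pow_pos2[of k r] by (auto simp: s_def k_def simp del: power_Suc)
      \<comment> \<open>The comparisons hold beyond \<open>X\<close> only; the splitting level \<open>s * x\<close> gets there
        because \<open>r \<ge> F x\<close> and \<open>F x\<close> decays at most like \<open>x^(-\<gamma>)\<close>.\<close>
      have "X \<le> s * x"
      proof -
        have "F x \<le> r" using G_le[OF x] G_pos[OF x] F_pos[of x] x
          by (simp add: r_def field_simps)
        have "X ^ k * 2 = 2 * X * X * X ^ \<gamma>" by (simp add: k_def power_add power2_eq_square)
        also have "\<dots> \<le> (F X * x) * x * X ^ \<gamma>"
        proof -
          have "2 * X \<le> F X * x" using elim F_pos[of X] by (simp add: field_simps)
          then have "(2 * X) * X \<le> (F X * x) * x"
            by (rule mult_mono) (use elim X x F_pos[of X] in auto)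
          then show ?thesis by (rule mult_right_mono) (use X in auto)
        qed
        also have "\<dots> = F X * (x\<^sup>2 * X ^ \<gamma>)" by (simp add: power2_eq_square)
        also have "\<dots> \<le> (2 * (x / X) ^ \<gamma> * F x) * (x\<^sup>2 * X ^ \<gamma>)"
          using reg[of X x] elim X by (intro mult_right_mono) auto
        also have "\<dots> = 2 * F x * x ^ k"
          using X by (simp add: k_def power_add power_divide field_simps power2_eq_square)
        also have "\<dots> \<le> 2 * r * x ^ k"
          using \<open>F x \<le> r\<close> x by simp
        also have "\<dots> = 2 * (s * x) ^ k" by (simp add: power_mult_distrib s)
        finally have "X ^ k \<le> (s * x) ^ k" by simp
        then show ?thesis
          using power_mono_iff[of X "s * x" k] X s x by (simp add: k_def)
      qed
      have le: "s * x \<le> x" using s x by simp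
      have sx: "0 < s * x" using s x by simp
      have "p (s * x) \<le> F (s * x) / G (s * x)" using x1 \<open>X \<le> s * x\<close> X by simp
      also have "\<dots> \<le> (2 / s ^ \<gamma> * F x) / (s * G x)"
      proof (rule frac_le)
        show "F (s * x) \<le> 2 / s ^ \<gamma> * F x"
          using reg[of "s * x" x] \<open>X \<le> s * x\<close> X le s x by (simp add: power_divide field_simps)
        show "s * G x \<le> G (s * x)"
          using G_star[OF sx le] x by simp
        show "0 < s * G x" using s G_pos[OF x] by simp
        show "0 \<le> 2 / s ^ \<gamma> * F x" using s F_pos[of x] by simp
      qed
      finally have "x * p (s * x) \<le> x * ((2 / s ^ \<gamma> * F x) / (s * G x))"
        by (rule mult_left_mono) (use x in simp)
      also have "\<dots> = 2 * r / (s ^ \<gamma> * s)" by (simp add: r_def field_simps)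
      also have "\<dots> = 2 * s" using s(1) by (simp flip: s(2) add: k_def power_add power2_eq_square)
      finally have "x * p (s * x) \<le> 2 * s" .
      moreover have "v x \<le> s * x / x * m + x * p (s * x)" using v_split[OF sx le] .
      ultimately have "v x \<le> (m + 2) * s" using x by (simp add: algebra_simps)
      then have "v x ^ k \<le> ((m + 2) * s) ^ k" using v_nonneg[OF x] by (intro power_mono)
      then show ?case using v_nonneg[OF x] r s by (simp add: power_mult_distrib flip: r_def)
    qed
  qed
  then show ?thesis by blast
qed

text \<open>The factor \<open>G x / x * v x\<close> is the price of the first level. On its own it is only
\<open>o(G x / x)\<close>, which may be much larger than \<open>F x\<close>; the power gained from further levels
makes up for the quotient \<open>x F(x) / G(x)\<close>.\<close>

lemma escapes_negligible: "\<exists>k. (\<lambda>x. G x / x * (v x * v x ^ k)) \<in> o(F)"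
proof -
  obtain k where k: "(\<lambda>x. v x ^ k) \<in> O(\<lambda>x. x * F x / G x)"
    using moment_power_bound by blast
  have "v \<in> o(\<lambda>_. 1)" using v_tendsto by (intro smalloI_tendsto) auto
  then have "(\<lambda>x. v x * v x ^ k) \<in> o(\<lambda>x. 1 * (x * F x / G x))"
    using k by (rule landau_o.small_big_mult)
  then have "(\<lambda>x. G x / x * (v x * v x ^ k)) \<in> o(\<lambda>x. G x / x * (1 * (x * F x / G x)))"
    by (rule landau_o.small.mult_left)
  also have "o(\<lambda>x. G x / x * (1 * (x * F x / G x))) = o(F)"
  proof (rule landau_o.small.cong)
    show "\<forall>\<^sub>F x in at_top. G x / x * (1 * (x * F x / G x)) = F x"
      using eventually_gt_at_top[of 0] by eventually_elim (use G_pos in force)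
  qed
  finally show ?thesis by blast
qed

end

section \<open>Truncated steps\<close>

text \<open>The summand is at most four times the increment of the bounded function
\<open>l \<mapsto> \<bar>t\<bar> l / (\<bar>t\<bar> + l)\<close>, so the sum telescopes.\<close>

lemma sum_min_square_le: "(\<Sum>l=1..n. min (t\<^sup>2 / (real l)\<^sup>2) 1) \<le> 4 * \<bar>t\<bar>" for t :: real
proof (cases "t = 0")
  case False
  define u where "u = \<bar>t\<bar>"
  have u: "0 < u" using False by (simp add: u_def)
  have "(\<Sum>l=1..n. min (u\<^sup>2 / (real l)\<^sup>2) 1) \<le> 4 * (u * n / (u + n))"
  proof (induction n)
    case (Suc n)
    define w where "w = min (u\<^sup>2 / (real (Suc n))\<^sup>2) 1"
    have pos: "0 < u + n" "0 < u + Suc n" using u by auto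
    have "w * ((u + n) * (u + Suc n)) \<le> 4 * u\<^sup>2"
    proof (cases "u \<le> Suc n")
      case True
      have "w * ((u + n) * (u + Suc n)) \<le> u\<^sup>2 / (real (Suc n))\<^sup>2 * ((2 * real (Suc n)) * (2 * real (Suc n)))"
        using True u by (intro mult_mono) (auto simp: w_def)
      also have "\<dots> = 4 * u\<^sup>2" by (simp add: power2_eq_square field_simps del: of_nat_Suc)
      finally show ?thesis .
    next
      case False
      have "w * ((u + n) * (u + Suc n)) \<le> 1 * ((2 * u) * (2 * u))"
        using False u by (intro mult_mono) (auto simp: w_def)
      then show ?thesis by (simp add: power2_eq_square)
    qed
    then have "w \<le> 4 * u\<^sup>2 / ((u + n) * (u + Suc n))"
      using pos by (simp add: pos_le_divide_eq)
    also have "\<dots> = 4 * (u * Suc n / (u + Suc n)) - 4 * (u * n / (u + n))"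
      using pos by (simp add: divide_simps power2_eq_square algebra_simps)
    finally show ?case using Suc by (simp add: w_def)
  qed simp
  also have "\<dots> \<le> 4 * u" using u by (simp add: field_simps)
  finally show ?thesis by (simp add: u_def)
qed simp

definition truncate :: "real \<Rightarrow> real \<Rightarrow> real" where
  "truncate b t = (if \<bar>t\<bar> \<le> b then t else 0)"

lemma truncate_measurable [measurable]: "truncate b \<in> borel_measurable borel"
  unfolding truncate_def[abs_def] by measurable

lemma abs_truncate_le: "0 \<le> b \<Longrightarrow> \<bar>truncate b t\<bar> \<le> b"
  by (simp add: truncate_def)

locale iid_steps = past_future M past future
  for M :: "'a measure" and past future :: "nat \<Rightarrow> 'a measure" +
  fixes X :: "nat \<Rightarrow> 'a \<Rightarrow> real" and \<xi> :: "'a \<Rightarrow> real"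
  assumes X_past: "\<And>i j. 0 < j \<Longrightarrow> j \<le> i \<Longrightarrow> X j \<in> borel_measurable (past i)"
    and X_future: "\<And>i j. i < j \<Longrightarrow> X j \<in> borel_measurable (future i)"
    and X_distr: "\<And>i. 0 < i \<Longrightarrow> distr M borel (X i) = distr M borel \<xi>"
    and \<xi>_int: "integrable M \<xi>"
begin

lemma X_meas: "0 < i \<Longrightarrow> X i \<in> borel_measurable M"
  by (rule past_measurable[OF X_past]) auto

lemma \<xi>_meas [measurable]: "\<xi> \<in> borel_measurable M"
  using \<xi>_int by (rule borel_measurable_integrable)

lemma expectation_step:
  fixes f :: "real \<Rightarrow> real"
  assumes "0 < i" and [measurable]: "f \<in> borel_measurable borel"
  shows "expectation (\<lambda>\<omega>. f (X i \<omega>)) = expectation (\<lambda>\<omega>. f (\<xi> \<omega>))"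
proof -
  have "expectation (\<lambda>\<omega>. f (X i \<omega>)) = integral\<^sup>L (distr M borel (X i)) f"
    by (rule integral_distr[symmetric]) (use X_meas assms in auto)
  also have "\<dots> = expectation (\<lambda>\<omega>. f (\<xi> \<omega>))"
    unfolding X_distr[OF \<open>0 < i\<close>] by (rule integral_distr) auto
  finally show ?thesis .
qed

lemma prob_step:
  assumes "0 < i" and [measurable]: "Measurable.pred borel Q"
  shows "prob {\<omega> \<in> space M. Q (X i \<omega>)} = prob {\<omega> \<in> space M. Q (\<xi> \<omega>)}"
proof -
  have Q: "{t. Q t} \<in> sets borel" by measurable
  have "prob (X i -` {t. Q t} \<inter> space M) = measure (distr M borel (X i)) {t. Q t}"
    by (rule measure_distr[symmetric]) (use X_meas assms Q in auto)
  also have "\<dots> = prob (\<xi> -` {t. Q t} \<inter> space M)"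
    unfolding X_distr[OF \<open>0 < i\<close>] by (rule measure_distr) (use Q in auto)
  finally show ?thesis by (simp add: vimage_def Int_def conj_commute)
qed

definition truncated_mean :: "real \<Rightarrow> real" where
  "truncated_mean b = expectation (\<lambda>\<omega>. truncate b (\<xi> \<omega>))"

definition capped_moment :: "real \<Rightarrow> real" where
  "capped_moment b = expectation (\<lambda>\<omega>. min ((\<xi> \<omega>)\<^sup>2) (b\<^sup>2))"

definition centred_step :: "real \<Rightarrow> nat \<Rightarrow> 'a \<Rightarrow> real" where
  "centred_step b i \<omega> = truncate b (X i \<omega>) - truncated_mean b"

lemma integrable_capped: "integrable M (\<lambda>\<omega>. min ((\<xi> \<omega>)\<^sup>2) (b\<^sup>2))"
  by (rule integrable_const_bound[of _ "b\<^sup>2"]) auto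

lemma capped_moment_nonneg: "0 \<le> capped_moment b"
  unfolding capped_moment_def by (intro Bochner_Integration.integral_nonneg) auto

lemma capped_moment_mono: "0 \<le> b \<Longrightarrow> b \<le> c \<Longrightarrow> capped_moment b \<le> capped_moment c"
  unfolding capped_moment_def
  by (intro integral_mono integrable_capped min.mono order_refl power_mono) auto

lemma integrable_truncate: "0 \<le> b \<Longrightarrow> integrable M (\<lambda>\<omega>. truncate b (\<xi> \<omega>))"
  by (rule integrable_const_bound[of _ b]) (auto simp: abs_truncate_le)

lemma abs_truncated_mean_le: "0 \<le> b \<Longrightarrow> \<bar>truncated_mean b\<bar> \<le> b"
proof -
  assume b: "0 \<le> b"
  have "\<bar>truncated_mean b\<bar> \<le> expectation (\<lambda>\<omega>. \<bar>truncate b (\<xi> \<omega>)\<bar>)"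
    unfolding truncated_mean_def by (rule integral_abs_bound)
  also have "\<dots> \<le> expectation (\<lambda>\<omega>. b)"
    using b by (intro integral_mono integrable_abs integrable_truncate) (auto simp: abs_truncate_le)
  finally show ?thesis by (simp add: prob_space)
qed

lemma truncated_mean_tendsto: "(truncated_mean \<longlongrightarrow> expectation \<xi>) at_top"
  unfolding truncated_mean_def
proof (rule integral_dominated_convergence_at_top)
  show "integrable M (\<lambda>\<omega>. \<bar>\<xi> \<omega>\<bar>)" using \<xi>_int by simp
  show "AE \<omega> in M. ((\<lambda>b. truncate b (\<xi> \<omega>)) \<longlongrightarrow> \<xi> \<omega>) at_top"
  proof (rule AE_I2)
    fix \<omega>
    have "\<forall>\<^sub>F b in at_top. truncate b (\<xi> \<omega>) = \<xi> \<omega>"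
      using eventually_ge_at_top[of "\<bar>\<xi> \<omega>\<bar>"] by eventually_elim (simp add: truncate_def)
    then show "((\<lambda>b. truncate b (\<xi> \<omega>)) \<longlongrightarrow> \<xi> \<omega>) at_top" by (rule tendsto_eventually)
  qed
  show "\<forall>\<^sub>F b in at_top. AE \<omega> in M. norm (truncate b (\<xi> \<omega>)) \<le> \<bar>\<xi> \<omega>\<bar>"
    by (intro always_eventually allI AE_I2) (simp add: truncate_def)
qed auto

lemma capped_moment_tendsto: "((\<lambda>x. capped_moment x / x) \<longlongrightarrow> 0) at_top"
proof -
  have "((\<lambda>x. expectation (\<lambda>\<omega>. min ((\<xi> \<omega>)\<^sup>2) (x\<^sup>2) / x)) \<longlongrightarrow> expectation (\<lambda>\<omega>. 0)) at_top"
  proof (rule integral_dominated_convergence_at_top)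
    show "integrable M (\<lambda>\<omega>. \<bar>\<xi> \<omega>\<bar>)" using \<xi>_int by simp
    show "AE \<omega> in M. ((\<lambda>x. min ((\<xi> \<omega>)\<^sup>2) (x\<^sup>2) / x) \<longlongrightarrow> 0) at_top"
    proof (rule AE_I2)
      fix \<omega>
      have "((\<lambda>x. (\<xi> \<omega>)\<^sup>2 / x) \<longlongrightarrow> 0) at_top"
        by (intro tendsto_divide_0[OF tendsto_const] filterlim_at_top_imp_at_infinity filterlim_ident)
      moreover have "\<forall>\<^sub>F x in at_top. min ((\<xi> \<omega>)\<^sup>2) (x\<^sup>2) / x = (\<xi> \<omega>)\<^sup>2 / x"
        using eventually_ge_at_top[of "\<bar>\<xi> \<omega>\<bar>"]
      proof eventually_elim
        case (elim x)
        then have "(\<xi> \<omega>)\<^sup>2 \<le> x\<^sup>2" using power_mono[of "\<bar>\<xi> \<omega>\<bar>" x 2] by simp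
        then show ?case by (simp add: min_def)
      qed
      ultimately show "((\<lambda>x. min ((\<xi> \<omega>)\<^sup>2) (x\<^sup>2) / x) \<longlongrightarrow> 0) at_top"
        by (rule tendsto_cong[THEN iffD2, rotated])
    qed
    show "\<forall>\<^sub>F x in at_top. AE \<omega> in M. norm (min ((\<xi> \<omega>)\<^sup>2) (x\<^sup>2) / x) \<le> \<bar>\<xi> \<omega>\<bar>"
      using eventually_gt_at_top[of 0]
    proof eventually_elim
      case (elim x)
      have "min (t\<^sup>2) (x\<^sup>2) \<le> \<bar>t\<bar> * x" for t
      proof (cases "\<bar>t\<bar> \<le> x")
        case True
        then have "\<bar>t\<bar> * \<bar>t\<bar> \<le> \<bar>t\<bar> * x" by (intro mult_left_mono) auto
        then show ?thesis by (simp add: power2_eq_square min.coboundedI1)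
      next
        case False
        then have "x * x \<le> \<bar>t\<bar> * x" using elim by (intro mult_right_mono) auto
        then show ?thesis by (simp add: power2_eq_square min.coboundedI2)
      qed
      then show ?case using elim by (auto simp: field_simps)
    qed
  qed auto
  then show ?thesis by (simp add: capped_moment_def)
qed

text \<open>The capped square is at most \<open>z * \<bar>\<xi>\<bar>\<close> where \<open>\<bar>\<xi>\<bar> \<le> z\<close>, and at most \<open>x\<^sup>2\<close> elsewhere.\<close>

lemma capped_moment_split:
  assumes "0 < z" "z \<le> x"
  shows "capped_moment x \<le> z * expectation (\<lambda>\<omega>. \<bar>\<xi> \<omega>\<bar>) + x\<^sup>2 * prob {\<omega> \<in> space M. \<bar>\<xi> \<omega>\<bar> > z}"
proof -
  have A: "{\<omega> \<in> space M. \<bar>\<xi> \<omega>\<bar> > z} \<in> events" by measurable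
  then have ind: "integrable M (indicator {\<omega> \<in> space M. \<bar>\<xi> \<omega>\<bar> > z} :: 'a \<Rightarrow> real)"
    by (intro integrable_real_indicator) (auto simp: emeasure_eq_measure)
  have "capped_moment x
      \<le> expectation (\<lambda>\<omega>. z * \<bar>\<xi> \<omega>\<bar> + x\<^sup>2 * indicator {\<omega> \<in> space M. \<bar>\<xi> \<omega>\<bar> > z} \<omega>)"
    unfolding capped_moment_def
  proof (intro integral_mono integrable_capped Bochner_Integration.integrable_add
      integrable_mult_right integrable_abs \<xi>_int ind)
    fix \<omega> assume \<omega>: "\<omega> \<in> space M"
    show "min ((\<xi> \<omega>)\<^sup>2) (x\<^sup>2) \<le> z * \<bar>\<xi> \<omega>\<bar> + x\<^sup>2 * indicator {\<omega> \<in> space M. \<bar>\<xi> \<omega>\<bar> > z} \<omega>"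
    proof (cases "\<bar>\<xi> \<omega>\<bar> > z")
      case True
      then show ?thesis using \<omega> assms by (simp add: min.coboundedI2)
    next
      case False
      then have "\<bar>\<xi> \<omega>\<bar> * \<bar>\<xi> \<omega>\<bar> \<le> z * \<bar>\<xi> \<omega>\<bar>" by (intro mult_right_mono) auto
      then show ?thesis using False by (simp add: power2_eq_square min.coboundedI1)
    qed
  qed
  also have "\<dots> = z * expectation (\<lambda>\<omega>. \<bar>\<xi> \<omega>\<bar>) + x\<^sup>2 * prob {\<omega> \<in> space M. \<bar>\<xi> \<omega>\<bar> > z}"
    using A ind \<xi>_int by simp
  finally show ?thesis .
qed

lemma centred_step_past: "0 < j \<Longrightarrow> j \<le> i \<Longrightarrow> centred_step b j \<in> borel_measurable (past i)"
  unfolding centred_step_def[abs_def]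
  by (intro borel_measurable_diff borel_measurable_const measurable_compose[OF X_past]) auto

lemma centred_step_future: "i < j \<Longrightarrow> centred_step b j \<in> borel_measurable (future i)"
  unfolding centred_step_def[abs_def]
  by (intro borel_measurable_diff borel_measurable_const measurable_compose[OF X_future]) auto

lemma abs_centred_step_le: "0 \<le> b \<Longrightarrow> \<bar>centred_step b i \<omega>\<bar> \<le> 2 * b"
  using abs_truncate_le[of b "X i \<omega>"] abs_truncated_mean_le[of b]
  unfolding centred_step_def by linarith

lemma centred_step_mean:
  assumes "0 < i" "0 \<le> b"
  shows "expectation (centred_step b i) = 0"
proof -
  have "expectation (\<lambda>\<omega>. truncate b (X i \<omega>) - truncated_mean b)
      = expectation (\<lambda>\<omega>. truncate b (\<xi> \<omega>) - truncated_mean b)"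
    using assms by (intro expectation_step[where f = "\<lambda>t. truncate b t - truncated_mean b"]) auto
  also have "\<dots> = 0"
    using integrable_truncate[OF assms(2)] by (simp add: truncated_mean_def prob_space)
  finally show ?thesis by (simp add: centred_step_def[abs_def])
qed

lemma centred_step_variance:
  assumes "0 < i" "0 \<le> b"
  shows "expectation (\<lambda>\<omega>. (centred_step b i \<omega>)\<^sup>2) \<le> capped_moment b"
proof -
  have sq: "integrable M (\<lambda>\<omega>. (truncate b (\<xi> \<omega>))\<^sup>2)"
    by (rule integrable_const_bound[of _ "b\<^sup>2"])
      (use power_mono[OF abs_truncate_le[OF assms(2)], of _ 2] in auto)
  have "expectation (\<lambda>\<omega>. (centred_step b i \<omega>)\<^sup>2)
      = expectation (\<lambda>\<omega>. (truncate b (\<xi> \<omega>) - truncated_mean b)\<^sup>2)"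
    using assms unfolding centred_step_def
    by (intro expectation_step[where f = "\<lambda>t. (truncate b t - truncated_mean b)\<^sup>2"]) auto
  also have "\<dots> = expectation (\<lambda>\<omega>. (truncate b (\<xi> \<omega>))\<^sup>2) - (truncated_mean b)\<^sup>2"
    unfolding truncated_mean_def using integrable_truncate[OF assms(2)] sq by (rule variance_eq)
  also have "\<dots> \<le> expectation (\<lambda>\<omega>. (truncate b (\<xi> \<omega>))\<^sup>2)" by simp
  also have "\<dots> \<le> capped_moment b"
    unfolding capped_moment_def
  proof (intro integral_mono sq integrable_capped)
    fix \<omega>
    show "(truncate b (\<xi> \<omega>))\<^sup>2 \<le> min ((\<xi> \<omega>)\<^sup>2) (b\<^sup>2)"
      using power_mono[of "\<bar>\<xi> \<omega>\<bar>" b 2] by (auto simp: truncate_def)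
  qed
  finally show ?thesis .
qed

text \<open>Without a step larger than \<open>b\<close>, the walk is the sum of the centred truncated steps plus a
drift that differs from \<open>k * a\<close> by at most \<open>\<delta>\<close>; the centred steps are bounded by \<open>2 * b\<close>.
Both ways to deviate carry the expected number of steps taken as a factor.\<close>

lemma prob_deviation_le:
  fixes B :: "nat \<Rightarrow> 'a set"
  assumes B_past: "\<And>i. B i \<in> sets (past i)" and B_decseq: "decseq B" and b: "0 < b"
    and drift: "n * \<bar>truncated_mean b - a\<bar> \<le> \<delta>"
    and v: "capped_moment b \<le> v"
  shows "prob {\<omega> \<in> space M. \<exists>k\<in>{0<..n}. \<omega> \<in> B (k - 1) \<and>
        \<bar>(\<Sum>i\<in>{0<..k}. X i \<omega>) - k * a\<bar> > (2 * real m + 1) * (2 * b) + \<delta>}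
    \<le> (\<Sum>i<n. prob (B i)) *
        (prob {\<omega> \<in> space M. \<bar>\<xi> \<omega>\<bar> > b} + v / (2 * b)\<^sup>2 * (n * v / (2 * b)\<^sup>2) ^ m)"
proof -
  let ?dev = "{\<omega> \<in> space M. \<exists>k\<in>{0<..n}. \<omega> \<in> B (k - 1) \<and>
        \<bar>(\<Sum>i\<in>{0<..k}. X i \<omega>) - k * a\<bar> > (2 * real m + 1) * (2 * b) + \<delta>}"
  let ?esc = "escape (centred_step b) B n ((2 * real m + 1) * (2 * b))"
  let ?J = "\<lambda>i. B i \<inter> {\<omega> \<in> space M. \<bar>X (Suc i) \<omega>\<bar> > b}"
  have B_ev: "B i \<in> events" for i using B_past sets_past by blast
  have B_mono: "B j \<subseteq> B i" if "i \<le> j" for i j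
    using B_decseq that by (auto simp: decseq_def)
  have jump_future: "{\<omega> \<in> space M. \<bar>X (Suc i) \<omega>\<bar> > b} \<in> sets (future i)" for i
  proof -
    have [measurable]: "X (Suc i) \<in> borel_measurable (future i)" by (rule X_future) simp
    have "{\<omega> \<in> space (future i). \<bar>X (Suc i) \<omega>\<bar> > b} \<in> sets (future i)" by measurable
    then show ?thesis by simp
  qed
  have J_ev: "?J i \<in> events" for i using B_ev jump_future sets_future by blast
  have esc_ev: "?esc \<in> events"
    by (intro sets_escape B_ev past_measurable[OF centred_step_past]) auto
  have "?dev \<subseteq> (\<Union>i\<in>{..<n}. ?J i) \<union> ?esc"
  proof
    fix \<omega> assume "\<omega> \<in> ?dev"
    then obtain k where \<omega>: "\<omega> \<in> space M" and k: "0 < k" "k \<le> n" "\<omega> \<in> B (k - 1)"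
      and far: "\<bar>(\<Sum>i\<in>{0<..k}. X i \<omega>) - k * a\<bar> > (2 * real m + 1) * (2 * b) + \<delta>"
      by auto
    show "\<omega> \<in> (\<Union>i\<in>{..<n}. ?J i) \<union> ?esc"
    proof (cases "\<exists>i\<in>{0<..k}. \<bar>X i \<omega>\<bar> > b")
      case True
      then obtain i where i: "0 < i" "i \<le> k" "\<bar>X i \<omega>\<bar> > b" by auto
      then have "\<omega> \<in> B (i - 1)" using k B_mono[of "i - 1" "k - 1"] by fastforce
      then have "\<omega> \<in> ?J (i - 1)" "i - 1 < n" using i k \<omega> by auto
      then show ?thesis by blast
    next
      case False
      have "(\<Sum>i\<in>{0<..k}. X i \<omega>) = (\<Sum>i\<in>{0<..k}. centred_step b i \<omega> + truncated_mean b)"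
        using False by (intro sum.cong) (auto simp: centred_step_def truncate_def not_less)
      also have "\<dots> = (\<Sum>i\<in>{0<..k}. centred_step b i \<omega>) + k * truncated_mean b"
        by (simp add: sum.distrib)
      finally have "(\<Sum>i\<in>{0<..k}. X i \<omega>) - k * a
          = (\<Sum>i\<in>{0<..k}. centred_step b i \<omega>) + k * (truncated_mean b - a)"
        by (simp add: algebra_simps)
      moreover have "\<bar>k * (truncated_mean b - a)\<bar> \<le> \<delta>"
      proof -
        have "\<bar>k * (truncated_mean b - a)\<bar> = k * \<bar>truncated_mean b - a\<bar>" by (simp add: abs_mult)
        also have "\<dots> \<le> n * \<bar>truncated_mean b - a\<bar>" using k by (intro mult_right_mono) auto
        finally show ?thesis using drift by simp
      qed
      ultimately have "\<bar>\<Sum>i\<in>{0<..k}. centred_step b i \<omega>\<bar> > (2 * real m + 1) * (2 * b)"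
        using far by linarith
      then have "\<omega> \<in> ?esc" using \<omega> k unfolding escape_def by auto
      then show ?thesis by blast
    qed
  qed
  then have "prob ?dev \<le> prob ((\<Union>i\<in>{..<n}. ?J i) \<union> ?esc)"
    using J_ev esc_ev by (intro finite_measure_mono) auto
  also have "\<dots> \<le> prob (\<Union>i\<in>{..<n}. ?J i) + prob ?esc"
    using J_ev esc_ev by (intro measure_Un_le) auto
  also have "prob (\<Union>i\<in>{..<n}. ?J i) \<le> (\<Sum>i<n. prob (?J i))"
    using J_ev by (intro finite_measure_subadditive_finite) auto
  also have "(\<Sum>i<n. prob (?J i)) = (\<Sum>i<n. prob (B i) * prob {\<omega> \<in> space M. \<bar>\<xi> \<omega>\<bar> > b})"
  proof (rule sum.cong[OF refl])
    fix i
    show "prob (?J i) = prob (B i) * prob {\<omega> \<in> space M. \<bar>\<xi> \<omega>\<bar> > b}"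
      using past_indep_future[OF B_past jump_future]
        prob_step[of "Suc i" "\<lambda>t. \<bar>t\<bar> > b"] by simp
  qed
  also have "\<dots> = (\<Sum>i<n. prob (B i)) * prob {\<omega> \<in> space M. \<bar>\<xi> \<omega>\<bar> > b}"
    by (rule sum_distrib_right[symmetric])
  also have "prob ?esc \<le> (\<Sum>i<n. prob (B i)) * v / (2 * b)\<^sup>2 * (n * v / (2 * b)\<^sup>2) ^ m"
  proof (rule prob_escape_power[OF centred_step_past centred_step_future _ _ _ B_past B_decseq])
    show "\<bar>centred_step b i \<omega>\<bar> \<le> 2 * b" "0 < 2 * b" for i \<omega>
      using b abs_centred_step_le[of b i \<omega>] by auto
    show "expectation (centred_step b i) = 0" if "0 < i" for i
      using that b by (intro centred_step_mean) auto
    show "expectation (\<lambda>\<omega>. (centred_step b i \<omega>)\<^sup>2) \<le> v" if "0 < i" for i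
      using centred_step_variance[OF that, of b] b v by linarith
  qed
  finally show ?thesis by (simp add: algebra_simps)
qed

end

section \<open>Late drops of a walk with positive drift\<close>

context iid_steps
begin

lemma summable_capped_moments:
  "summable (\<lambda>l. capped_moment (real (Suc l)) / (real (Suc l))\<^sup>2)"
proof (rule summableI_nonneg_bounded)
  fix n
  have summand: "capped_moment (real (Suc l)) / (real (Suc l))\<^sup>2
      = expectation (\<lambda>\<omega>. min ((\<xi> \<omega>)\<^sup>2 / (real (Suc l))\<^sup>2) 1)" for l
  proof -
    have "capped_moment (real (Suc l)) / (real (Suc l))\<^sup>2
        = expectation (\<lambda>\<omega>. min ((\<xi> \<omega>)\<^sup>2) ((real (Suc l))\<^sup>2) / (real (Suc l))\<^sup>2)"
      by (simp add: capped_moment_def del: of_nat_Suc)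
    also have "\<dots> = expectation (\<lambda>\<omega>. min ((\<xi> \<omega>)\<^sup>2 / (real (Suc l))\<^sup>2) 1)"
      by (intro Bochner_Integration.integral_cong refl)
        (auto simp: min_def divide_simps simp del: of_nat_Suc)
    finally show ?thesis .
  qed
  have int: "integrable M (\<lambda>\<omega>. min ((\<xi> \<omega>)\<^sup>2 / (real l)\<^sup>2) 1)" for l
    by (rule integrable_const_bound[of _ 1]) auto
  have "(\<Sum>l<n. capped_moment (real (Suc l)) / (real (Suc l))\<^sup>2)
      = (\<Sum>l<n. expectation (\<lambda>\<omega>. min ((\<xi> \<omega>)\<^sup>2 / (real (Suc l))\<^sup>2) 1))"
    by (simp only: summand)
  also have "\<dots> = expectation (\<lambda>\<omega>. \<Sum>l<n. min ((\<xi> \<omega>)\<^sup>2 / (real (Suc l))\<^sup>2) 1)"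
    by (intro Bochner_Integration.integral_sum[symmetric] int)
  also have "\<dots> \<le> expectation (\<lambda>\<omega>. 4 * \<bar>\<xi> \<omega>\<bar>)"
  proof (intro integral_mono Bochner_Integration.integrable_sum int integrable_mult_right integrable_abs \<xi>_int)
    fix \<omega>
    have "(\<Sum>l<n. min ((\<xi> \<omega>)\<^sup>2 / (real (Suc l))\<^sup>2) 1) = (\<Sum>l=1..n. min ((\<xi> \<omega>)\<^sup>2 / (real l)\<^sup>2) 1)"
      by (simp add: sum.atLeast1_atMost_eq del: of_nat_Suc)
    then show "(\<Sum>l<n. min ((\<xi> \<omega>)\<^sup>2 / (real (Suc l))\<^sup>2) 1) \<le> 4 * \<bar>\<xi> \<omega>\<bar>"
      using sum_min_square_le[of "\<xi> \<omega>" n] by simp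
  qed
  finally show "(\<Sum>l<n. capped_moment (real (Suc l)) / (real (Suc l))\<^sup>2)
      \<le> expectation (\<lambda>\<omega>. 4 * \<bar>\<xi> \<omega>\<bar>)" .
qed (simp add: capped_moment_nonneg)

lemma prob_jump_le:
  assumes "0 < b"
  shows "prob {\<omega> \<in> space M. \<bar>\<xi> \<omega>\<bar> > b} \<le> capped_moment b / b\<^sup>2"
proof -
  have "prob {\<omega> \<in> space M. \<bar>\<xi> \<omega>\<bar> > b} \<le> prob {\<omega> \<in> space M. min ((\<xi> \<omega>)\<^sup>2) (b\<^sup>2) \<ge> b\<^sup>2}"
  proof (rule finite_measure_mono)
    show "{\<omega> \<in> space M. \<bar>\<xi> \<omega>\<bar> > b} \<subseteq> {\<omega> \<in> space M. min ((\<xi> \<omega>)\<^sup>2) (b\<^sup>2) \<ge> b\<^sup>2}"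
      using assms power_mono[of b "\<bar>\<xi> _\<bar>" 2] by auto
    show "{\<omega> \<in> space M. min ((\<xi> \<omega>)\<^sup>2) (b\<^sup>2) \<ge> b\<^sup>2} \<in> events" by measurable
  qed
  also have "\<dots> \<le> capped_moment b / b\<^sup>2"
    unfolding capped_moment_def using assms
    by (intro integral_Markov_inequality_measure[OF integrable_capped, of "{}"]) auto
  finally show ?thesis .
qed

text \<open>The strong law of large numbers in a form that is uniform in the starting time \<open>N\<close>. The
\<open>j\<close>-th step after \<open>N\<close> is truncated at \<open>L + j\<close> and, once centred, divided by \<open>L + j\<close>. The sum
over \<open>l > L\<close> of the summable series above bounds the probability that a step is
truncated and, by Kolmogorov's inequality, up to the factor \<open>16 / a\<^sup>2\<close> also the
probability that the weighted sums \<open>U\<close> ever leave \<open>[-a / 4, a / 4]\<close>. Otherwise the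
fluctuations after \<open>K\<close> steps are at least \<open>- (L + 2 K) a / 4\<close>, and the drift, at least
\<open>K a / 2\<close>, compensates all of this except for the constant \<open>L a / 4\<close>.\<close>

lemma no_later_drop:
  assumes a: "a = expectation \<xi>" "0 < a" and \<nu>: "0 < \<nu>"
  shows "\<exists>y. \<forall>N. prob {\<omega> \<in> space M. \<exists>k>N. (\<Sum>i\<in>{N<..k}. X i \<omega>) < - y} \<le> \<nu>"
proof -
  define w where "w l = capped_moment (real (Suc l)) / (real (Suc l))\<^sup>2" for l
  have w: "summable w" "\<And>l. 0 \<le> w l"
    using summable_capped_moments by (auto simp: w_def[abs_def] capped_moment_nonneg)
  define c where "c = 1 + 16 / a\<^sup>2"
  have c: "0 < c" by (simp add: c_def add_pos_nonneg)
  have "\<forall>\<^sub>F l in sequentially. norm (\<Sum>i. w (i + l)) < \<nu> / c"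
    using suminf_exist_split[of "\<nu> / c" w] w \<nu> c by (auto simp: eventually_sequentially)
  moreover have "\<forall>\<^sub>F l in sequentially. a / 2 < truncated_mean (real l)"
  proof -
    have "((\<lambda>l. truncated_mean (real l)) \<longlongrightarrow> a) sequentially"
      unfolding a by (rule filterlim_compose[OF truncated_mean_tendsto filterlim_real_sequentially])
    then show ?thesis by (rule order_tendstoD) (use a in simp)
  qed
  ultimately have "\<forall>\<^sub>F l in sequentially. norm (\<Sum>i. w (i + l)) < \<nu> / c \<and> a / 2 < truncated_mean (real l)"
    by eventually_elim simp
  then obtain L where L: "\<And>l. L \<le> l \<Longrightarrow> norm (\<Sum>i. w (i + l)) < \<nu> / c \<and> a / 2 < truncated_mean (real l)"
    unfolding eventually_sequentially by blast
  have tail: "(\<Sum>j<n. w (j + L)) \<le> \<nu> / c" for n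
  proof -
    have "(\<Sum>j<n. w (j + L)) \<le> (\<Sum>i. w (i + L))"
      by (rule sum_le_suminf) (use w summable_iff_shift[of w L] in auto)
    then show ?thesis using L[of L] by auto
  qed
  define y where "y = a / 2 * real L"
  \<comment> \<open>Each finite horizon obeys the same bound, which therefore passes to the
    infinite one.\<close>
  have bound: "prob {\<omega> \<in> space M. \<exists>k\<in>{N<..N+n}. (\<Sum>i\<in>{N<..k}. X i \<omega>) < - y} \<le> \<nu>" for N n
  proof -
    define lev where "lev i = real (L + (i - N))" for i
    have lev: "0 < lev i" "real L \<le> lev i" "a / 2 < truncated_mean (lev i)" if "N < i" for i
      using that L[of "L + (i - N)"] by (auto simp: lev_def)
    define Y where "Y i \<omega> = centred_step (lev i) i \<omega> / lev i" for i \<omega>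
    define U where "U k \<omega> = (\<Sum>i\<in>{N<..k}. Y i \<omega>)" for k \<omega>
    let ?drop = "{\<omega> \<in> space M. \<exists>k\<in>{N<..N+n}. (\<Sum>i\<in>{N<..k}. X i \<omega>) < - y}"
    let ?fluct = "{\<omega> \<in> space M. \<exists>k\<in>{N<..N+n}. \<omega> \<in> space M \<and> \<bar>\<Sum>i\<in>{N<..k}. Y i \<omega>\<bar> > a / 4}"
    let ?J = "\<lambda>j. {\<omega> \<in> space M. \<bar>X (Suc (N + j)) \<omega>\<bar> > lev (Suc (N + j))}"
    have Y_sq: "integrable M (\<lambda>\<omega>. (Y i \<omega>)\<^sup>2) \<and> expectation (\<lambda>\<omega>. (Y i \<omega>)\<^sup>2) \<le> w (L + (i - N) - 1)
        \<and> expectation (Y i) = 0 \<and> Y i \<in> borel_measurable M" if "N < i" for i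
    proof -
      have [measurable]: "centred_step (lev i) i \<in> borel_measurable M"
        by (rule past_measurable[OF centred_step_past]) (use that in auto)
      have "integrable M (\<lambda>\<omega>. (centred_step (lev i) i \<omega>)\<^sup>2)"
        by (rule integrable_const_bound[of _ "(2 * lev i)\<^sup>2"])
          (use power_mono[OF abs_centred_step_le[of "lev i"], of i _ 2] lev[OF that] in auto)
      moreover have "expectation (\<lambda>\<omega>. (centred_step (lev i) i \<omega>)\<^sup>2) \<le> capped_moment (lev i)"
        using lev[OF that] that by (intro centred_step_variance) auto
      moreover have "w (L + (i - N) - 1) = capped_moment (lev i) / (lev i)\<^sup>2"
      proof -
        have "Suc (L + (i - N) - 1) = L + (i - N)" using that by simp
        then show ?thesis by (simp only: w_def lev_def)
      qed
      moreover have "expectation (centred_step (lev i) i) = 0"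
        using lev[OF that] that by (intro centred_step_mean) auto
      ultimately show ?thesis
        by (auto simp: Y_def[abs_def] power_divide divide_right_mono)
    qed
    have fluct: "prob ?fluct \<le> 16 / a\<^sup>2 * (\<nu> / c)"
    proof -
      have "prob ?fluct
          \<le> (\<Sum>i\<in>{N..<N+n}. prob (space M) * expectation (\<lambda>\<omega>. (Y (Suc i) \<omega>)\<^sup>2)) / (a / 4)\<^sup>2"
      proof (rule kolmogorov_while_alive)
        show "Y j \<in> borel_measurable (past i)" if "N < j" "j \<le> i" for i j
          unfolding Y_def[abs_def] using that
          by (intro borel_measurable_divide centred_step_past borel_measurable_const) auto
        show "Y (Suc i) \<in> borel_measurable (future i)" for i
          unfolding Y_def[abs_def]
          by (intro borel_measurable_divide centred_step_future borel_measurable_const) auto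
        show "space M \<in> sets (past i)" for i
          using sets.top[of "past i"] by simp
      qed (use Y_sq a in \<open>auto simp: decseq_def\<close>)
      also have "\<dots> = (\<Sum>j<n. expectation (\<lambda>\<omega>. (Y (Suc (N + j)) \<omega>)\<^sup>2)) / (a / 4)\<^sup>2"
        by (simp add: prob_space sum.atLeastLessThan_shift_0[of _ N "N + n"] lessThan_atLeast0)
      also have "\<dots> \<le> (\<Sum>j<n. w (j + L)) / (a / 4)\<^sup>2"
      proof (intro divide_right_mono sum_mono)
        fix j
        show "expectation (\<lambda>\<omega>. (Y (Suc (N + j)) \<omega>)\<^sup>2) \<le> w (j + L)"
          using Y_sq[of "Suc (N + j)"] by (simp add: add.commute)
      qed simp
      also have "\<dots> \<le> (\<nu> / c) / (a / 4)\<^sup>2"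
        by (rule divide_right_mono[OF tail]) simp
      also have "\<dots> = 16 / a\<^sup>2 * (\<nu> / c)" by (simp add: power_divide mult_ac)
      finally show ?thesis .
    qed
    have J_ev: "?J j \<in> events" for j
    proof -
      have [measurable]: "X (Suc (N + j)) \<in> borel_measurable M" by (rule X_meas) simp
      show ?thesis by measurable
    qed
    have jump: "prob (\<Union>j\<in>{..<n}. ?J j) \<le> \<nu> / c"
    proof -
      have "prob (\<Union>j\<in>{..<n}. ?J j) \<le> (\<Sum>j<n. prob (?J j))"
        using J_ev by (intro finite_measure_subadditive_finite) auto
      also have "\<dots> \<le> (\<Sum>j<n. w (j + L))"
      proof (rule sum_mono)
        fix j
        have "prob (?J j) = prob {\<omega> \<in> space M. \<bar>\<xi> \<omega>\<bar> > lev (Suc (N + j))}"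
          by (rule prob_step[where Q = "\<lambda>t. \<bar>t\<bar> > lev (Suc (N + j))"]) auto
        also have "\<dots> \<le> w (j + L)"
          using prob_jump_le[OF lev(1), of "Suc (N + j)"] by (simp add: w_def lev_def add_ac)
        finally show "prob (?J j) \<le> w (j + L)" .
      qed
      finally show ?thesis using tail[of n] by simp
    qed
    have fluct_ev: "?fluct \<in> events"
    proof -
      have "{\<omega> \<in> space M. \<omega> \<in> space M \<and> \<bar>\<Sum>i\<in>{N<..k}. Y i \<omega>\<bar> > a / 4} \<in> events" for k
      proof -
        have [measurable]: "(\<lambda>\<omega>. \<Sum>i\<in>{N<..k}. Y i \<omega>) \<in> borel_measurable M"
          using Y_sq by (intro borel_measurable_sum) auto
        show ?thesis by measurable
      qed
      then show ?thesis by (intro sets.sets_Collect_finite_Ex) auto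
    qed
    have "?drop \<subseteq> (\<Union>j\<in>{..<n}. ?J j) \<union> ?fluct"
    proof
      fix \<omega> assume "\<omega> \<in> ?drop"
      then obtain k where \<omega>: "\<omega> \<in> space M" and k: "N < k" "k \<le> N + n"
        and low: "(\<Sum>i\<in>{N<..k}. X i \<omega>) < - y" by auto
      show "\<omega> \<in> (\<Union>j\<in>{..<n}. ?J j) \<union> ?fluct"
      proof (rule ccontr)
        assume "\<not> ?thesis"
        then have small: "\<And>j. j < n \<Longrightarrow> \<bar>X (Suc (N + j)) \<omega>\<bar> \<le> lev (Suc (N + j))"
          and U_le: "\<And>k. N < k \<Longrightarrow> k \<le> N + n \<Longrightarrow> \<bar>U k \<omega>\<bar> \<le> a / 4"
          using \<omega> by (auto simp: U_def not_less)
        have U_le': "\<bar>U (N + j) \<omega>\<bar> \<le> a / 4" if "j \<le> n" for j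
          using U_le[of "N + j"] that a by (cases "j = 0") (auto simp: U_def)
        have X_eq: "X i \<omega> = centred_step (lev i) i \<omega> + truncated_mean (lev i)" if "N < i" "i \<le> N + n" for i
          using small[of "i - Suc N"] that by (simp add: centred_step_def truncate_def)
        \<comment> \<open>Summation by parts turns the bound on the weighted sums \<open>U\<close> into a linear one.\<close>
        have parts: "(\<Sum>i\<in>{N<..N+K}. centred_step (lev i) i \<omega>)
            = (L + K) * U (N + K) \<omega> - (\<Sum>j<K. U (N + j) \<omega>)" for K
        proof (induction K)
          case 0
          show ?case by (simp add: U_def)
        next
          case (Suc K)
          have I: "{N<..N + Suc K} = insert (N + Suc K) {N<..N + K}" by auto
          have "U (N + Suc K) \<omega> = U (N + K) \<omega> + Y (N + Suc K) \<omega>"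
            unfolding U_def I by simp
          moreover have "centred_step (lev (N + Suc K)) (N + Suc K) \<omega> = (L + Suc K) * Y (N + Suc K) \<omega>"
            using lev(1)[of "N + Suc K"] by (simp add: Y_def lev_def del: of_nat_Suc)
          ultimately show ?case
            unfolding I using Suc by (simp add: algebra_simps)
        qed
        define K where "K = k - N"
        have K: "k = N + K" "K \<le> n" using k by (auto simp: K_def)
        have "(\<Sum>i\<in>{N<..k}. X i \<omega>)
            = (\<Sum>i\<in>{N<..k}. centred_step (lev i) i \<omega>) + (\<Sum>i\<in>{N<..k}. truncated_mean (lev i))"
          using k by (simp add: X_eq sum.distrib[symmetric])
        moreover have "(\<Sum>i\<in>{N<..k}. truncated_mean (lev i)) \<ge> K * (a / 2)"
          using sum_mono[of "{N<..k}" "\<lambda>_. a / 2" "\<lambda>i. truncated_mean (lev i)"] lev(3)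
          by (auto simp: K_def less_imp_le)
        moreover have "(\<Sum>i\<in>{N<..k}. centred_step (lev i) i \<omega>) \<ge> - ((L + K) * (a / 4)) - K * (a / 4)"
        proof -
          have "- (a / 4) \<le> U (N + K) \<omega>" using U_le'[OF K(2)] by simp
          then have "(L + K) * (- (a / 4)) \<le> (L + K) * U (N + K) \<omega>" by (intro mult_left_mono) auto
          moreover have "(\<Sum>j<K. U (N + j) \<omega>) \<le> (\<Sum>j<K. a / 4)"
          proof (rule sum_mono)
            fix j assume "j \<in> {..<K}"
            then show "U (N + j) \<omega> \<le> a / 4" using U_le'[of j] K by auto
          qed
          ultimately show ?thesis unfolding K(1) parts by simp
        qed
        ultimately have "(\<Sum>i\<in>{N<..k}. X i \<omega>) \<ge> - (L * (a / 4))"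
          by (simp add: algebra_simps add_divide_distrib)
        also have "- (L * (a / 4)) \<ge> - y" using a by (simp add: y_def)
        finally show False using low by simp
      qed
    qed
    then have "prob ?drop \<le> prob ((\<Union>j\<in>{..<n}. ?J j) \<union> ?fluct)"
      using J_ev fluct_ev by (intro finite_measure_mono) auto
    also have "\<dots> \<le> prob (\<Union>j\<in>{..<n}. ?J j) + prob ?fluct"
      using J_ev fluct_ev by (intro measure_Un_le) auto
    also have "\<dots> \<le> \<nu> / c + 16 / a\<^sup>2 * (\<nu> / c)" using jump fluct by simp
    also have "\<dots> = c * (\<nu> / c)" by (simp only: c_def distrib_right mult_1)
    also have "\<dots> = \<nu>" using c by simp
    finally show ?thesis .
  qed
  have "prob {\<omega> \<in> space M. \<exists>k>N. (\<Sum>i\<in>{N<..k}. X i \<omega>) < - y} \<le> \<nu>" for N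
  proof -
    let ?A = "\<lambda>n. {\<omega> \<in> space M. \<exists>k\<in>{N<..N+n}. (\<Sum>i\<in>{N<..k}. X i \<omega>) < - y}"
    have A_ev: "?A n \<in> events" for n
    proof -
      have "{\<omega> \<in> space M. (\<Sum>i\<in>{N<..k}. X i \<omega>) < - y} \<in> events" for k
      proof -
        have [measurable]: "(\<lambda>\<omega>. \<Sum>i\<in>{N<..k}. X i \<omega>) \<in> borel_measurable M"
          using X_meas by (intro borel_measurable_sum) auto
        show ?thesis by measurable
      qed
      then show ?thesis by (intro sets.sets_Collect_finite_Ex) auto
    qed
    have "incseq ?A"
    proof (rule incseq_SucI)
      fix n
      have "{N<..N+n} \<subseteq> {N<..N+Suc n}" by auto
      then show "?A n \<subseteq> ?A (Suc n)" by blast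
    qed
    then have "(\<lambda>n. prob (?A n)) \<longlonglongrightarrow> prob (\<Union>n. ?A n)"
      using A_ev by (intro finite_Lim_measure_incseq) auto
    then have "prob (\<Union>n. ?A n) \<le> \<nu>"
      by (rule LIMSEQ_le_const2) (use bound in blast)
    also have "(\<Union>n. ?A n) = {\<omega> \<in> space M. \<exists>k>N. (\<Sum>i\<in>{N<..k}. X i \<omega>) < - y}" (is "?l = ?r")
    proof
      show "?l \<subseteq> ?r" by auto
      show "?r \<subseteq> ?l"
      proof
        fix \<omega> assume "\<omega> \<in> ?r"
        then obtain k where "\<omega> \<in> space M" "N < k" "(\<Sum>i\<in>{N<..k}. X i \<omega>) < - y" by blast
        then have "\<omega> \<in> ?A (k - N)" by auto
        then show "\<omega> \<in> ?l" by blast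
      qed
    qed
    finally show ?thesis .
  qed
  then show ?thesis by blast
qed

end

section \<open>Deviations from the drift while alive\<close>

lemma asymp_equiv_sandwich:
  fixes f g :: "real \<Rightarrow> real"
  assumes g: "\<And>x. 0 < g x"
    and upper: "\<And>\<theta>. 0 < \<theta> \<Longrightarrow> \<forall>\<^sub>F x in at_top. f x \<le> (1 + \<theta>) * g x"
    and lower: "\<And>\<theta>. 0 < \<theta> \<Longrightarrow> \<forall>\<^sub>F x in at_top. (1 - \<theta>) * g x \<le> f x"
  shows "f \<sim>[at_top] g"
proof (rule asymp_equivI', rule tendstoI)
  fix e :: real assume e: "0 < e"
  then have "0 < e / 2" by simp
  show "\<forall>\<^sub>F x in at_top. dist (f x / g x) 1 < e"
    using upper[OF \<open>0 < e / 2\<close>] lower[OF \<open>0 < e / 2\<close>]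
  proof eventually_elim
    case (elim x)
    have "f x / g x \<le> 1 + e / 2" "1 - e / 2 \<le> f x / g x"
      using elim g[of x] by (auto simp: pos_divide_le_eq pos_le_divide_eq)
    then have "\<bar>f x / g x - 1\<bar> \<le> e / 2" by linarith
    then show ?case using e by (simp add: dist_real_def)
  qed
qed

text \<open>For each tolerance \<open>\<theta>\<close> the limit supplies one small \<open>\<epsilon>\<close>, and \<open>r = 1 - \<epsilon>\<close>.\<close>

lemma intermediate_regularly_varyingD:
  assumes D: "intermediate_regularly_varying D" and \<theta>: "0 < \<theta>"
  shows "\<exists>r>0. r < 1 \<and> (\<forall>\<^sub>F x in at_top. tail D (r * x) \<le> (1 + \<theta>) * tail D x)"
proof -
  let ?L = "\<lambda>\<epsilon>::real. Limsup at_top (\<lambda>x. ereal (tail D ((1 - \<epsilon>) * x) / tail D x))"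
  have pos: "\<And>x. 0 < tail D x" and lim: "(?L \<longlongrightarrow> 1) (at_right 0)"
    using D by (auto simp: intermediate_regularly_varying_def)
  have "\<forall>\<^sub>F \<epsilon> in at_right 0. ?L \<epsilon> < ereal (1 + \<theta>)"
    using lim by (rule order_tendstoD) (use \<theta> in simp)
  moreover have "\<forall>\<^sub>F \<epsilon> in at_right 0. \<epsilon> < (1::real)"
    by (rule order_tendstoD(2)[OF tendsto_ident_at]) simp
  moreover have "\<forall>\<^sub>F \<epsilon> in at_right 0. (0::real) < \<epsilon>"
    by (rule eventually_at_right_less)
  ultimately have "\<forall>\<^sub>F \<epsilon> in at_right 0. ?L \<epsilon> < ereal (1 + \<theta>) \<and> \<epsilon> < 1 \<and> 0 < \<epsilon>"
    by eventually_elim simp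
  then obtain \<epsilon> where \<epsilon>: "?L \<epsilon> < ereal (1 + \<theta>)" "\<epsilon> < 1" "0 < \<epsilon>"
    using eventually_happens trivial_limit_at_right_real by blast
  have "\<forall>\<^sub>F x in at_top. ereal (tail D ((1 - \<epsilon>) * x) / tail D x) < ereal (1 + \<theta>)"
    using \<epsilon>(1) by (rule Limsup_lessD)
  then have "\<forall>\<^sub>F x in at_top. tail D ((1 - \<epsilon>) * x) \<le> (1 + \<theta>) * tail D x"
    by eventually_elim (use pos in \<open>simp add: pos_divide_less_eq less_imp_le\<close>)
  then show ?thesis using \<epsilon> by (intro exI[of _ "1 - \<epsilon>"]) auto
qed

text \<open>The step truncation \<open>b = \<beta> * x\<close> is chosen so small that \<open>2 k + 1\<close> levels of height \<open>2 * b\<close>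
fit into half of the distance \<open>\<epsilon> * x\<close>; the other half absorbs the bias of the truncated
mean, which tends to \<open>a\<close>. Here \<open>k\<close> is the number of additional levels that
\<open>escapes_negligible\<close> asks for.\<close>

lemma (in iid_steps) deviation_negligible:
  fixes B :: "nat \<Rightarrow> 'a set" and F G :: "real \<Rightarrow> real" and a \<epsilon> :: real
  assumes B_past: "\<And>i. B i \<in> sets (past i)" and B_decseq: "decseq B"
    and tails: "tail_comparison F G (\<lambda>x. prob {\<omega> \<in> space M. \<bar>\<xi> \<omega>\<bar> > x})
      (\<lambda>x. capped_moment x / x) m"
    and lifetime: "(\<lambda>x. \<Sum>i<nat \<lfloor>x\<rfloor>. prob (B i)) \<in> O(G)"
    and a: "a = expectation \<xi>" and \<epsilon>: "0 < \<epsilon>"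
  shows "(\<lambda>x. prob {\<omega> \<in> space M. \<exists>k\<in>{0<..nat \<lfloor>x\<rfloor>}. \<omega> \<in> B (k - 1) \<and>
      \<bar>(\<Sum>i\<in>{0<..k}. X i \<omega>) - k * a\<bar> > \<epsilon> * x}) \<in> o(F)"
proof -
  interpret tail_comparison F G "\<lambda>x. prob {\<omega> \<in> space M. \<bar>\<xi> \<omega>\<bar> > x}" "\<lambda>x. capped_moment x / x" m
    by (rule tails)
  define p where "p x = prob {\<omega> \<in> space M. \<bar>\<xi> \<omega>\<bar> > x}" for x
  define v where "v x = capped_moment x / x" for x
  obtain k where k: "(\<lambda>x. G x / x * (v x * v x ^ k)) \<in> o(F)"
    using escapes_negligible unfolding v_def by blast
  define \<beta> where "\<beta> = min 1 (\<epsilon> / (4 * (2 * real k + 1)))"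
  have \<beta>: "0 < \<beta>" "\<beta> \<le> 1" using \<epsilon> by (auto simp: \<beta>_def)
  have levels: "(2 * real k + 1) * (2 * (\<beta> * x)) + \<epsilon> / 2 * x \<le> \<epsilon> * x" if "0 < x" for x
  proof -
    have "\<beta> \<le> \<epsilon> / (4 * (2 * real k + 1))" by (simp add: \<beta>_def)
    then have "\<beta> * (4 * (2 * real k + 1)) \<le> \<epsilon>" by (simp add: pos_le_divide_eq)
    then have "\<beta> * (4 * (2 * real k + 1)) * x \<le> \<epsilon> * x" using that by (intro mult_right_mono) auto
    then show ?thesis by (simp add: algebra_simps)
  qed
  define c where "c = 1 / (4 * \<beta>\<^sup>2)"
  have c: "0 < c" using \<beta> by (simp add: c_def)
  define R where "R x = G x * p (\<beta> * x) + c * c ^ k * (G x / x * (v x * v x ^ k))" for x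
  have R: "R \<in> o(F)"
    unfolding R_def p_def
    by (intro sum_in_smallo big_jumps_negligible \<beta> landau_o.small.cmult_in_iff[THEN iffD2, OF _ k] k)
      (use c in auto)
  obtain K where K: "0 < K" and
    "\<forall>\<^sub>F x in at_top. norm (\<Sum>i<nat \<lfloor>x\<rfloor>. prob (B i)) \<le> K * norm (G x)"
    using landau_o.bigE[OF lifetime] by blast
  note this(2)
  moreover have "\<forall>\<^sub>F x in at_top. \<bar>truncated_mean (\<beta> * x) - a\<bar> < \<epsilon> / 2"
  proof -
    have "filterlim (\<lambda>x. \<beta> * x) at_top at_top"
      using \<beta> by (intro filterlim_tendsto_pos_mult_at_top[OF tendsto_const] filterlim_ident) auto
    then have "((\<lambda>x. truncated_mean (\<beta> * x)) \<longlongrightarrow> a) at_top"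
      unfolding a by (rule filterlim_compose[OF truncated_mean_tendsto])
    from tendstoD[OF this, of "\<epsilon> / 2"] \<epsilon> show ?thesis by (simp add: dist_real_def)
  qed
  ultimately have bound: "\<forall>\<^sub>F x in at_top. prob {\<omega> \<in> space M. \<exists>k\<in>{0<..nat \<lfloor>x\<rfloor>}. \<omega> \<in> B (k - 1) \<and>
      \<bar>(\<Sum>i\<in>{0<..k}. X i \<omega>) - k * a\<bar> > \<epsilon> * x} \<le> K * R x"
    using eventually_gt_at_top[of 0]
  proof eventually_elim
    case (elim x)
    let ?n = "nat \<lfloor>x\<rfloor>"
    let ?dev = "\<lambda>y. {\<omega> \<in> space M. \<exists>k\<in>{0<..?n}. \<omega> \<in> B (k - 1) \<and>
      \<bar>(\<Sum>i\<in>{0<..k}. X i \<omega>) - k * a\<bar> > y}"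
    have x: "0 < x" and n: "real ?n \<le> x" using elim by auto
    have B_ev: "B i \<in> events" for i using B_past sets_past by blast
    have dev_ev: "?dev y \<in> events" for y
    proof -
      have "{\<omega> \<in> space M. \<omega> \<in> B (k - 1) \<and> \<bar>(\<Sum>i\<in>{0<..k}. X i \<omega>) - k * a\<bar> > y} \<in> events" for k
      proof -
        have [measurable]: "(\<lambda>\<omega>. \<Sum>i\<in>{0<..k}. X i \<omega>) \<in> borel_measurable M"
          using X_meas by (intro borel_measurable_sum) auto
        have [measurable]: "B (k - 1) \<in> events" by (rule B_ev)
        show ?thesis by measurable
      qed
      then show ?thesis by (intro sets.sets_Collect_finite_Ex) auto
    qed
    have "prob (?dev (\<epsilon> * x)) \<le> prob (?dev ((2 * real k + 1) * (2 * (\<beta> * x)) + \<epsilon> / 2 * x))"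
    proof (rule finite_measure_mono[OF _ dev_ev])
      show "?dev (\<epsilon> * x) \<subseteq> ?dev ((2 * real k + 1) * (2 * (\<beta> * x)) + \<epsilon> / 2 * x)"
        using levels[OF x] by (blast intro: le_less_trans)
    qed
    also have "\<dots> \<le> (\<Sum>i<?n. prob (B i)) *
        (prob {\<omega> \<in> space M. \<bar>\<xi> \<omega>\<bar> > \<beta> * x} +
          capped_moment x / (2 * (\<beta> * x))\<^sup>2 * (?n * capped_moment x / (2 * (\<beta> * x))\<^sup>2) ^ k)"
    proof (rule prob_deviation_le[OF B_past B_decseq])
      show "0 < \<beta> * x" using \<beta> x by simp
      show "capped_moment (\<beta> * x) \<le> capped_moment x"
        using \<beta> x by (intro capped_moment_mono) auto
      have "?n * \<bar>truncated_mean (\<beta> * x) - a\<bar> \<le> x * (\<epsilon> / 2)"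
        using elim n x by (intro mult_mono) auto
      then show "?n * \<bar>truncated_mean (\<beta> * x) - a\<bar> \<le> \<epsilon> / 2 * x" by (simp add: mult.commute)
    qed
    also have "\<dots> \<le> (K * G x) * (p (\<beta> * x) + c * v x / x * (c * v x) ^ k)"
    proof (rule mult_mono)
      show "(\<Sum>i<?n. prob (B i)) \<le> K * G x"
        using elim G_pos[OF x] by (simp add: sum_nonneg)
      have sq: "capped_moment x / (2 * (\<beta> * x))\<^sup>2 = c * v x / x"
        using x by (simp add: c_def v_def power_mult_distrib power2_eq_square)
      have "?n * capped_moment x / (2 * (\<beta> * x))\<^sup>2 = ?n * (c * v x / x)"
        by (simp flip: sq)
      also have "\<dots> \<le> x * (c * v x / x)"
        using n c x capped_moment_nonneg[of x] by (intro mult_right_mono) (auto simp: v_def)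
      finally have "?n * capped_moment x / (2 * (\<beta> * x))\<^sup>2 \<le> c * v x" using x by simp
      then have "(?n * capped_moment x / (2 * (\<beta> * x))\<^sup>2) ^ k \<le> (c * v x) ^ k"
        using capped_moment_nonneg[of x] by (intro power_mono) auto
      then show "prob {\<omega> \<in> space M. \<bar>\<xi> \<omega>\<bar> > \<beta> * x} +
          capped_moment x / (2 * (\<beta> * x))\<^sup>2 * (?n * capped_moment x / (2 * (\<beta> * x))\<^sup>2) ^ k
          \<le> p (\<beta> * x) + c * v x / x * (c * v x) ^ k"
        unfolding sq p_def using c x capped_moment_nonneg[of x]
        by (intro add_mono order_refl mult_left_mono) (auto simp: v_def)
      show "0 \<le> K * G x" using K G_pos[OF x] by simp
      show "0 \<le> prob {\<omega> \<in> space M. \<bar>\<xi> \<omega>\<bar> > \<beta> * x} +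
          capped_moment x / (2 * (\<beta> * x))\<^sup>2 * (?n * capped_moment x / (2 * (\<beta> * x))\<^sup>2) ^ k"
        using capped_moment_nonneg[of x] by (intro add_nonneg_nonneg mult_nonneg_nonneg) auto
    qed
    also have "\<dots> = K * R x" by (simp add: R_def power_mult_distrib field_simps)
    finally show ?case .
  qed
  have "(\<lambda>x. prob {\<omega> \<in> space M. \<exists>k\<in>{0<..nat \<lfloor>x\<rfloor>}. \<omega> \<in> B (k - 1) \<and>
      \<bar>(\<Sum>i\<in>{0<..k}. X i \<omega>) - k * a\<bar> > \<epsilon> * x}) \<in> O(R)"
  proof (rule bigoI)
    show "\<forall>\<^sub>F x in at_top. norm (prob {\<omega> \<in> space M. \<exists>k\<in>{0<..nat \<lfloor>x\<rfloor>}. \<omega> \<in> B (k - 1) \<and>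
      \<bar>(\<Sum>i\<in>{0<..k}. X i \<omega>) - k * a\<bar> > \<epsilon> * x}) \<le> K * norm (R x)"
      using bound
    proof eventually_elim
      case (elim x)
      have "K * R x \<le> K * norm (R x)" using K by (intro mult_left_mono) auto
      then show ?case using elim by simp
    qed
  qed
  then show ?thesis using R by (rule landau_o.big_small_trans)
qed

section \<open>Randomly stopped walks\<close>

text \<open>A walk stopped at a time that does not depend on the future. Survival of \<open>n\<close> belongs
to the past of \<open>n\<close> for positive \<open>n\<close> only, because independence of the future starts at 1.\<close>

locale stopped_walk = iid_steps M past future X \<xi>
  for M :: "'a measure" and past future :: "nat \<Rightarrow> 'a measure"
    and X :: "nat \<Rightarrow> 'a \<Rightarrow> real" and \<xi> :: "'a \<Rightarrow> real" +
  fixes \<tau> :: "'a \<Rightarrow> nat" and a :: real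
  assumes \<tau>_past: "\<And>n. 0 < n \<Longrightarrow> {\<omega> \<in> space M. n < \<tau> \<omega>} \<in> sets (past n)"
    and \<tau>_meas [measurable]: "\<tau> \<in> measurable M (count_space UNIV)"
    and mean: "a = expectation \<xi>" and mean_pos: "0 < a"
    and tail_pos: "\<And>x. 0 < prob {\<omega> \<in> space M. x < real (\<tau> \<omega>)}"
    and regular: "\<And>\<theta>. 0 < \<theta> \<Longrightarrow> \<exists>r>0. r < 1 \<and> (\<forall>\<^sub>F x in at_top.
        prob {\<omega> \<in> space M. r * x < real (\<tau> \<omega>)} \<le> (1 + \<theta>) * prob {\<omega> \<in> space M. x < real (\<tau> \<omega>)})"
    and small_jumps: "(\<lambda>x. prob {\<omega> \<in> space M. \<bar>\<xi> \<omega>\<bar> > x}) \<in>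
        o(\<lambda>x. prob {\<omega> \<in> space M. x < real (\<tau> \<omega>)} / expectation (\<lambda>\<omega>. min (real (\<tau> \<omega>)) x))"
begin

definition time_tail :: "real \<Rightarrow> real" where "time_tail x = prob {\<omega> \<in> space M. x < real (\<tau> \<omega>)}"

definition capped_time :: "real \<Rightarrow> real" where "capped_time x = expectation (\<lambda>\<omega>. min (real (\<tau> \<omega>)) x)"

text \<open>The event that step \<open>i + 1\<close> is taken. Independence of the future says nothing about
\<open>{\<tau> = 0}\<close> and the first step, so that step is always counted as taken; this raises the
mean number of steps by at most one.\<close>

definition alive :: "nat \<Rightarrow> 'a set" where
  "alive i = (if i = 0 then space M else {\<omega> \<in> space M. i < \<tau> \<omega>})"

definition deviates :: "real \<Rightarrow> real \<Rightarrow> 'a set" where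
  "deviates \<epsilon> x = {\<omega> \<in> space M. \<exists>k\<in>{0<..nat \<lfloor>x\<rfloor>}. \<omega> \<in> alive (k - 1) \<and>
      \<bar>(\<Sum>i\<in>{0<..k}. X i \<omega>) - k * a\<bar> > \<epsilon> * x}"

lemma alive_past: "alive i \<in> sets (past i)"
  using \<tau>_past[of i] sets.top[of "past i"] by (cases "i = 0") (simp_all add: alive_def)

lemma alive_events: "alive i \<in> events"
  using alive_past sets_past by blast

lemma decseq_alive: "decseq alive"
  by (rule decseq_SucI) (auto simp: alive_def)

lemma integrable_capped_time: "integrable M (\<lambda>\<omega>. min (real (\<tau> \<omega>)) x)"
  by (rule integrable_const_bound[of _ "\<bar>x\<bar>"]) auto

lemma capped_time_mono: "x \<le> y \<Longrightarrow> capped_time x \<le> capped_time y"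
  unfolding capped_time_def by (intro integral_mono integrable_capped_time) auto

lemma comparison:
  "tail_comparison time_tail capped_time (\<lambda>x. prob {\<omega> \<in> space M. \<bar>\<xi> \<omega>\<bar> > x})
     (\<lambda>x. capped_moment x / x) (expectation (\<lambda>\<omega>. \<bar>\<xi> \<omega>\<bar>))"
proof
  show "0 < time_tail x" for x by (simp add: time_tail_def tail_pos)
  show "time_tail y \<le> time_tail x" if "x \<le> y" for x y
    unfolding time_tail_def using that by (intro finite_measure_mono) auto
  show "\<exists>r>0. r < 1 \<and> (\<forall>\<^sub>F x in at_top. time_tail (r * x) \<le> 2 * time_tail x)"
    using regular[of 1] by (simp add: time_tail_def)
  show "x * time_tail x \<le> capped_time x" if "0 < x" for x
  proof -
    have ev: "{\<omega> \<in> space M. x < real (\<tau> \<omega>)} \<in> events" by measurable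
    then have ind: "integrable M (indicator {\<omega> \<in> space M. x < real (\<tau> \<omega>)} :: 'a \<Rightarrow> real)"
      by (intro integrable_real_indicator) (auto simp: emeasure_eq_measure)
    have "x * time_tail x = expectation (\<lambda>\<omega>. x * indicator {\<omega> \<in> space M. x < real (\<tau> \<omega>)} \<omega>)"
      using ev by (simp add: time_tail_def)
    also have "\<dots> \<le> capped_time x"
      unfolding capped_time_def using that
      by (intro integral_mono integrable_capped_time integrable_mult_right ind)
        (auto simp: indicator_def)
    finally show ?thesis .
  qed
  show "capped_time x \<le> x" if "0 < x" for x
  proof -
    have "capped_time x \<le> expectation (\<lambda>\<omega>. x)"
      unfolding capped_time_def by (intro integral_mono integrable_capped_time) auto
    then show ?thesis by (simp add: prob_space)
  qed
  show "z / x * capped_time x \<le> capped_time z" if "0 < z" "z \<le> x" for z x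
  proof -
    have "z / x * capped_time x = expectation (\<lambda>\<omega>. z / x * min (real (\<tau> \<omega>)) x)" by (simp add: capped_time_def)
    also have "\<dots> \<le> capped_time z"
      unfolding capped_time_def
    proof (intro integral_mono integrable_capped_time integrable_mult_right)
      fix \<omega>
      have "z / x * real (\<tau> \<omega>) \<le> 1 * real (\<tau> \<omega>)" using that by (intro mult_right_mono) auto
      moreover have "z / x * min (real (\<tau> \<omega>)) x \<le> z / x * real (\<tau> \<omega>)"
        using that by (intro mult_left_mono) auto
      moreover have "z / x * min (real (\<tau> \<omega>)) x \<le> z / x * x"
        using that by (intro mult_left_mono) auto
      ultimately show "z / x * min (real (\<tau> \<omega>)) x \<le> min (real (\<tau> \<omega>)) z" using that by simp
    qed
    finally show ?thesis .
  qed
  show "(\<lambda>x. prob {\<omega> \<in> space M. \<bar>\<xi> \<omega>\<bar> > x}) \<in> o(\<lambda>x. time_tail x / capped_time x)"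
    using small_jumps by (simp add: time_tail_def capped_time_def)
  show "0 \<le> capped_moment x / x" if "0 < x" for x
    using that capped_moment_nonneg by simp
  show "capped_moment x / x \<le> z / x * expectation (\<lambda>\<omega>. \<bar>\<xi> \<omega>\<bar>) + x * prob {\<omega> \<in> space M. \<bar>\<xi> \<omega>\<bar> > z}"
    if "0 < z" "z \<le> x" for z x
  proof -
    have "capped_moment x / x
        \<le> (z * expectation (\<lambda>\<omega>. \<bar>\<xi> \<omega>\<bar>) + x\<^sup>2 * prob {\<omega> \<in> space M. \<bar>\<xi> \<omega>\<bar> > z}) / x"
      using that by (intro divide_right_mono capped_moment_split) auto
    also have "\<dots> = z / x * expectation (\<lambda>\<omega>. \<bar>\<xi> \<omega>\<bar>) + x * prob {\<omega> \<in> space M. \<bar>\<xi> \<omega>\<bar> > z}"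
      using that by (simp add: add_divide_distrib power2_eq_square)
    finally show ?thesis .
  qed
  show "((\<lambda>x. capped_moment x / x) \<longlongrightarrow> 0) at_top" by (rule capped_moment_tendsto)
qed

sublocale tail_comparison time_tail capped_time "\<lambda>x. prob {\<omega> \<in> space M. \<bar>\<xi> \<omega>\<bar> > x}"
    "\<lambda>x. capped_moment x / x" "expectation (\<lambda>\<omega>. \<bar>\<xi> \<omega>\<bar>)"
  by (rule comparison)

lemma sum_alive_le: "(\<Sum>i<n. prob (alive i)) \<le> 1 + capped_time (real n)"
proof -
  let ?A = "\<lambda>i. {\<omega> \<in> space M. i < \<tau> \<omega>}"
  have ev: "?A i \<in> events" for i by measurable
  have ind: "integrable M (indicator (?A i) :: 'a \<Rightarrow> real)" for i
    using ev by (intro integrable_real_indicator) (auto simp: emeasure_eq_measure)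
  have "(\<Sum>i<n. prob (alive i)) \<le> (\<Sum>i<n. (if i = 0 then 1 else 0) + prob (?A i))"
    by (intro sum_mono) (auto simp: alive_def prob_space)
  also have "\<dots> \<le> 1 + (\<Sum>i<n. prob (?A i))"
    by (simp add: sum.distrib sum.If_cases)
  also have "(\<Sum>i<n. prob (?A i)) = expectation (\<lambda>\<omega>. \<Sum>i<n. indicator (?A i) \<omega>)"
    using ev ind by (subst Bochner_Integration.integral_sum) auto
  also have "\<dots> = capped_time (real n)"
    unfolding capped_time_def
  proof (rule Bochner_Integration.integral_cong[OF refl])
    fix \<omega> assume "\<omega> \<in> space M"
    have "{..<n} \<inter> {i. i < \<tau> \<omega>} = {..<min n (\<tau> \<omega>)}" by auto
    then show "(\<Sum>i<n. indicator (?A i) \<omega>) = min (real (\<tau> \<omega>)) (real n)"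
      using \<open>\<omega> \<in> space M\<close> by (simp add: indicator_def sum.If_cases of_nat_min min.commute)
  qed
  finally show ?thesis by simp
qed

lemma lifetime_bigo: "(\<lambda>x. \<Sum>i<nat \<lfloor>x\<rfloor>. prob (alive i)) \<in> O(capped_time)"
proof (rule bigoI)
  show "\<forall>\<^sub>F x in at_top. norm (\<Sum>i<nat \<lfloor>x\<rfloor>. prob (alive i)) \<le> (1 / capped_time 1 + 1) * norm (capped_time x)"
    using eventually_ge_at_top[of 1]
  proof eventually_elim
    case (elim x)
    have "capped_time 1 \<le> capped_time x" "capped_time (real (nat \<lfloor>x\<rfloor>)) \<le> capped_time x" using elim by (auto intro: capped_time_mono)
    moreover have "0 < capped_time 1" by (rule G_pos) simp
    moreover have "1 \<le> capped_time x / capped_time 1" using calculation by simp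
    moreover have "(1 / capped_time 1 + 1) * capped_time x = capped_time x / capped_time 1 + capped_time x" by (simp add: distrib_right)
    ultimately have "1 + capped_time (real (nat \<lfloor>x\<rfloor>)) \<le> (1 / capped_time 1 + 1) * capped_time x" by linarith
    then show ?case
      using sum_alive_le[of "nat \<lfloor>x\<rfloor>"] G_pos[of x] elim by (simp add: sum_nonneg)
  qed
qed

lemma deviates_le:
  assumes "0 < \<epsilon>" "0 < \<theta>"
  shows "\<forall>\<^sub>F x in at_top. prob (deviates \<epsilon> x) \<le> \<theta> * time_tail x"
proof -
  have "(\<lambda>x. prob (deviates \<epsilon> x)) \<in> o(time_tail)"
    unfolding deviates_def
    by (rule deviation_negligible[OF alive_past decseq_alive comparison lifetime_bigo mean assms(1)])
  from landau_o.smallD[OF this assms(2)] show ?thesis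
    by eventually_elim (use F_pos in \<open>simp add: less_imp_le\<close>)
qed

lemma sum_measurable [measurable]: "(\<lambda>\<omega>. \<Sum>i\<in>{0<..k}. X i \<omega>) \<in> borel_measurable M"
  using X_meas by (intro borel_measurable_sum) auto

lemma deviates_events: "deviates \<epsilon> x \<in> events"
proof -
  have "{\<omega> \<in> space M. \<omega> \<in> alive (k - 1) \<and> \<bar>(\<Sum>i\<in>{0<..k}. X i \<omega>) - k * a\<bar> > \<epsilon> * x} \<in> events" for k
  proof -
    have [measurable]: "alive (k - 1) \<in> events" by (rule alive_events)
    show ?thesis by measurable
  qed
  then show ?thesis unfolding deviates_def by (intro sets.sets_Collect_finite_Ex) auto
qed

text \<open>If the walk exceeds \<open>a * x\<close> at some \<open>k \<le> \<tau> \<le> r * x\<close>, then it is ahead of its drift by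
more than \<open>a * (1 - r) * x\<close>.\<close>

lemma max_upper:
  assumes \<theta>: "0 < \<theta>"
  shows "\<forall>\<^sub>F x in at_top.
    prob {\<omega> \<in> space M. \<exists>k\<le>\<tau> \<omega>. (\<Sum>i\<in>{0<..k}. X i \<omega>) > a * x} \<le> (1 + \<theta>) * time_tail x"
proof -
  obtain r where r: "0 < r" "r < 1"
    and reg: "\<forall>\<^sub>F x in at_top. time_tail (r * x) \<le> (1 + \<theta> / 2) * time_tail x"
    using regular[of "\<theta> / 2"] \<theta> unfolding time_tail_def by auto
  have "0 < a * (1 - r)" using r mean_pos by simp
  moreover have "0 < \<theta> / 2" using \<theta> by simp
  ultimately have "\<forall>\<^sub>F x in at_top. prob (deviates (a * (1 - r)) x) \<le> \<theta> / 2 * time_tail x"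
    by (rule deviates_le)
  then show ?thesis
    using reg eventually_gt_at_top[of 0]
  proof eventually_elim
    case (elim x)
    have "{\<omega> \<in> space M. \<exists>k\<le>\<tau> \<omega>. (\<Sum>i\<in>{0<..k}. X i \<omega>) > a * x}
        \<subseteq> {\<omega> \<in> space M. r * x < real (\<tau> \<omega>)} \<union> deviates (a * (1 - r)) x"
    proof
      fix \<omega> assume "\<omega> \<in> {\<omega> \<in> space M. \<exists>k\<le>\<tau> \<omega>. (\<Sum>i\<in>{0<..k}. X i \<omega>) > a * x}"
      then obtain k where \<omega>: "\<omega> \<in> space M" and k: "k \<le> \<tau> \<omega>" "(\<Sum>i\<in>{0<..k}. X i \<omega>) > a * x" by blast
      show "\<omega> \<in> {\<omega> \<in> space M. r * x < real (\<tau> \<omega>)} \<union> deviates (a * (1 - r)) x"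
      proof (cases "r * x < real (\<tau> \<omega>)")
        case True
        then show ?thesis using \<omega> by simp
      next
        case False
        have "0 < a * x" using mean_pos elim by simp
        then have "0 < k" using k by (cases "k = 0") auto
        have kx: "real k \<le> r * x" using False k by linarith
        then have "real k \<le> x" using r elim mult_right_mono[of r 1 x] by linarith
        then have "k \<in> {0<..nat \<lfloor>x\<rfloor>}" using \<open>0 < k\<close> by (simp add: le_nat_floor)
        moreover have "\<omega> \<in> alive (k - 1)" using \<omega> k \<open>0 < k\<close> by (auto simp: alive_def)
        moreover have "\<bar>(\<Sum>i\<in>{0<..k}. X i \<omega>) - k * a\<bar> > a * (1 - r) * x"
        proof -
          have "k * a \<le> r * x * a" using kx mean_pos by (intro mult_right_mono) auto
          then have "a * (1 - r) * x < (\<Sum>i\<in>{0<..k}. X i \<omega>) - k * a"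
            using k by (simp add: algebra_simps)
          then show ?thesis by linarith
        qed
        ultimately show ?thesis using \<omega> unfolding deviates_def by blast
      qed
    qed
    then have "prob {\<omega> \<in> space M. \<exists>k\<le>\<tau> \<omega>. (\<Sum>i\<in>{0<..k}. X i \<omega>) > a * x}
        \<le> prob ({\<omega> \<in> space M. r * x < real (\<tau> \<omega>)} \<union> deviates (a * (1 - r)) x)"
      by (rule finite_measure_mono[OF _ sets.Un[OF _ deviates_events]]) measurable
    also have "\<dots> \<le> time_tail (r * x) + prob (deviates (a * (1 - r)) x)"
      unfolding time_tail_def by (rule measure_Un_le[OF _ deviates_events]) measurable
    also have "\<dots> \<le> (1 + \<theta> / 2) * time_tail x + \<theta> / 2 * time_tail x" using elim by simp
    finally show ?case by (simp add: algebra_simps)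
  qed
qed

text \<open>Let \<open>x = r * u\<close> with \<open>r < 1\<close> and \<open>\<tau> > u\<close>. At time \<open>N = \<lfloor>u\<rfloor>\<close> the walk is above \<open>a * x\<close> by a
margin linear in \<open>u\<close>, unless it deviates. Afterwards, up to the time \<open>\<tau>\<close>, it loses that
margin only by a late drop, which is a future event and hence independent of \<open>{\<tau> > N}\<close>.
Regular variation replaces the tail at \<open>u\<close> by the tail at \<open>x\<close>.\<close>

lemma stopped_lower:
  assumes \<theta>: "0 < \<theta>"
  shows "\<forall>\<^sub>F x in at_top.
    (1 - \<theta>) * time_tail x \<le> prob {\<omega> \<in> space M. (\<Sum>i\<in>{0<..\<tau> \<omega>}. X i \<omega>) > a * x}"
proof -
  define \<eta> where "\<eta> = \<theta> / 3"
  have \<eta>: "0 < \<eta>" and "\<theta> = 3 * \<eta>" using \<theta> by (simp_all add: \<eta>_def)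
  obtain r where r: "0 < r" "r < 1"
    and reg: "\<forall>\<^sub>F u in at_top. time_tail (r * u) \<le> (1 + \<eta>) * time_tail u"
    using regular[OF \<eta>] unfolding time_tail_def by auto
  obtain y where y: "\<And>N. prob {\<omega> \<in> space M. \<exists>k>N. (\<Sum>i\<in>{N<..k}. X i \<omega>) < - y} \<le> \<eta>"
    using no_later_drop[OF mean mean_pos \<eta>] by blast
  define \<epsilon> where "\<epsilon> = a * (1 - r) / 2"
  have \<epsilon>: "0 < \<epsilon>" using r mean_pos by (simp add: \<epsilon>_def)
  have S_ev: "{\<omega> \<in> space M. (\<Sum>i\<in>{0<..\<tau> \<omega>}. X i \<omega>) > z} \<in> events" for z
  proof -
    have "{\<omega> \<in> space M. \<exists>k. \<tau> \<omega> = k \<and> (\<Sum>i\<in>{0<..k}. X i \<omega>) > z} \<in> events" by measurable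
    then show ?thesis by simp
  qed
  have "\<forall>\<^sub>F u in at_top. (1 - \<theta>) * time_tail (r * u)
      \<le> prob {\<omega> \<in> space M. (\<Sum>i\<in>{0<..\<tau> \<omega>}. X i \<omega>) > a * (r * u)}"
    using reg deviates_le[OF \<epsilon> \<eta>] eventually_ge_at_top[of 1]
      eventually_ge_at_top[of "(a + y) / \<epsilon>"]
  proof eventually_elim
    case (elim u)
    define N where "N = nat \<lfloor>u\<rfloor>"
    have N: "0 < N" "real N \<le> u" "u - 1 < real N"
      using elim by (auto simp: N_def)
    let ?D = "{\<omega> \<in> space M. \<exists>k>N. (\<Sum>i\<in>{N<..k}. X i \<omega>) < - y}"
    let ?L = "{\<omega> \<in> space M. N < \<tau> \<omega>}"
    let ?S = "{\<omega> \<in> space M. (\<Sum>i\<in>{0<..\<tau> \<omega>}. X i \<omega>) > a * (r * u)}"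
    \<comment> \<open>\<open>\<tau>\<close> is integer valued.\<close>
    have L_eq: "?L = {\<omega> \<in> space M. u < real (\<tau> \<omega>)}"
    proof -
      have "N < n \<longleftrightarrow> u < real n" for n using N by linarith
      then show ?thesis by simp
    qed
    have D_future: "?D \<in> sets (future N)"
    proof -
      have [measurable]: "(\<lambda>\<omega>. \<Sum>i\<in>{N<..k}. X i \<omega>) \<in> borel_measurable (future N)" for k
        using X_future by (intro borel_measurable_sum) auto
      have "{\<omega> \<in> space (future N). \<exists>k>N. (\<Sum>i\<in>{N<..k}. X i \<omega>) < - y} \<in> sets (future N)"
        by measurable
      then show ?thesis by (simp only: space_future)
    qed
    have L_past: "?L \<in> sets (past N)" by (rule \<tau>_past[OF N(1)])
    have LD_ev: "?L \<inter> ?D \<in> events" using L_past D_future sets_past sets_future by blast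
    have cover: "?L \<subseteq> (?S \<union> deviates \<epsilon> u) \<union> (?L \<inter> ?D)"
    proof
      fix \<omega> assume \<omega>: "\<omega> \<in> ?L"
      show "\<omega> \<in> (?S \<union> deviates \<epsilon> u) \<union> (?L \<inter> ?D)"
      proof (rule ccontr)
        assume no: "\<not> ?thesis"
        then have "\<omega> \<notin> deviates \<epsilon> u" by blast
        moreover have "\<omega> \<in> alive (N - 1)" "N \<in> {0<..nat \<lfloor>u\<rfloor>}"
          using \<omega> N by (auto simp: alive_def N_def)
        ultimately have "\<not> \<bar>(\<Sum>i\<in>{0<..N}. X i \<omega>) - N * a\<bar> > \<epsilon> * u"
          using \<omega> unfolding deviates_def by blast
        then have "(\<Sum>i\<in>{0<..N}. X i \<omega>) \<ge> N * a - \<epsilon> * u" by linarith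
        moreover have "\<not> (\<Sum>i\<in>{N<..\<tau> \<omega>}. X i \<omega>) < - y" using no \<omega> by blast
        moreover have "(\<Sum>i\<in>{0<..\<tau> \<omega>}. X i \<omega>)
            = (\<Sum>i\<in>{0<..N}. X i \<omega>) + (\<Sum>i\<in>{N<..\<tau> \<omega>}. X i \<omega>)"
        proof -
          have "{0<..\<tau> \<omega>} = {0<..N} \<union> {N<..\<tau> \<omega>}" using \<omega> by auto
          then show ?thesis by (simp add: sum.union_disjoint)
        qed
        moreover have "a * u - a < N * a"
          using mult_strict_right_mono[OF N(3) mean_pos] by (simp add: algebra_simps)
        moreover have "a + y \<le> \<epsilon> * u" using elim \<epsilon> by (simp add: pos_divide_le_eq mult.commute)
        moreover have "2 * (\<epsilon> * u) = a * u - a * (r * u)"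
        proof -
          have "2 * (\<epsilon> * u) = a * (1 - r) * u" by (simp add: \<epsilon>_def)
          then show ?thesis by (simp add: algebra_simps)
        qed
        ultimately have "(\<Sum>i\<in>{0<..\<tau> \<omega>}. X i \<omega>) > a * (r * u)"
          by linarith
        then show False using no \<omega> by blast
      qed
    qed
    have un: "?S \<union> deviates \<epsilon> u \<in> events" by (intro sets.Un S_ev deviates_events)
    have "time_tail u = prob ?L" by (simp only: time_tail_def L_eq)
    also have "\<dots> \<le> prob ((?S \<union> deviates \<epsilon> u) \<union> (?L \<inter> ?D))"
      by (rule finite_measure_mono[OF cover sets.Un[OF un LD_ev]])
    also have "\<dots> \<le> prob (?S \<union> deviates \<epsilon> u) + prob (?L \<inter> ?D)"
      by (rule measure_Un_le[OF un LD_ev])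
    also have "\<dots> \<le> prob ?S + prob (deviates \<epsilon> u) + prob (?L \<inter> ?D)"
      by (intro add_right_mono measure_Un_le S_ev deviates_events)
    also have "prob (?L \<inter> ?D) \<le> time_tail u * \<eta>"
    proof -
      have "prob (?L \<inter> ?D) = prob ?L * prob ?D" by (rule past_indep_future[OF L_past D_future])
      also have "\<dots> \<le> prob ?L * \<eta>" by (intro mult_left_mono y) simp
      finally show ?thesis by (simp only: time_tail_def L_eq)
    qed
    finally have "time_tail u \<le> prob ?S + prob (deviates \<epsilon> u) + time_tail u * \<eta>" by simp
    moreover have "(1 - 2 * \<eta>) * time_tail u = time_tail u - \<eta> * time_tail u - time_tail u * \<eta>" by (simp add: algebra_simps)
    ultimately have low: "(1 - 2 * \<eta>) * time_tail u \<le> prob ?S" using elim(2) by linarith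
    show ?case
    proof (cases "\<theta> < 1")
      case True
      then have "(1 - \<theta>) * time_tail (r * u) \<le> (1 - \<theta>) * ((1 + \<eta>) * time_tail u)"
        using elim by (intro mult_left_mono) auto
      also have "\<dots> = (1 - 2 * \<eta> - 3 * \<eta>\<^sup>2) * time_tail u"
        unfolding \<open>\<theta> = 3 * \<eta>\<close> by (simp add: power2_eq_square algebra_simps)
      also have "\<dots> \<le> (1 - 2 * \<eta>) * time_tail u"
        using F_pos[of u] by (intro mult_right_mono) auto
      finally show ?thesis using low by linarith
    next
      case False
      then have "(1 - \<theta>) * time_tail (r * u) \<le> 0" using F_pos[of "r * u"] by (simp add: mult_nonpos_nonneg)
      also have "0 \<le> prob ?S" by (rule measure_nonneg)
      finally show ?thesis .
    qed
  qed
  moreover have "filterlim (\<lambda>x. x / r) at_top at_top"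
    using r filterlim_tendsto_pos_mult_at_top[OF tendsto_const[of "1 / r"] _ filterlim_ident] by simp
  ultimately have "\<forall>\<^sub>F x in at_top. (1 - \<theta>) * time_tail (r * (x / r))
      \<le> prob {\<omega> \<in> space M. (\<Sum>i\<in>{0<..\<tau> \<omega>}. X i \<omega>) > a * (r * (x / r))}"
    by (rule eventually_compose_filterlim)
  then show ?thesis using r by simp
qed

lemma stopped_asymptotics:
  shows max_asymp: "(\<lambda>x. prob {\<omega> \<in> space M. \<exists>k\<le>\<tau> \<omega>. (\<Sum>i\<in>{0<..k}. X i \<omega>) > x})
      \<sim>[at_top] (\<lambda>x. time_tail (x / a))"
    and sum_asymp: "(\<lambda>x. prob {\<omega> \<in> space M. (\<Sum>i\<in>{0<..\<tau> \<omega>}. X i \<omega>) > x})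
      \<sim>[at_top] (\<lambda>x. time_tail (x / a))"
proof -
  let ?P = "\<lambda>x. prob {\<omega> \<in> space M. \<exists>k\<le>\<tau> \<omega>. (\<Sum>i\<in>{0<..k}. X i \<omega>) > x}"
  let ?Q = "\<lambda>x. prob {\<omega> \<in> space M. (\<Sum>i\<in>{0<..\<tau> \<omega>}. X i \<omega>) > x}"
  have scale: "filterlim (\<lambda>x. x / a) at_top at_top"
    using mean_pos filterlim_tendsto_pos_mult_at_top[OF tendsto_const[of "1 / a"] _ filterlim_ident]
    by simp
  have upper: "\<forall>\<^sub>F x in at_top. ?P x \<le> (1 + \<theta>) * time_tail (x / a)" if "0 < \<theta>" for \<theta>
    using eventually_compose_filterlim[OF max_upper[OF that] scale] mean_pos by simp
  have lower: "\<forall>\<^sub>F x in at_top. (1 - \<theta>) * time_tail (x / a) \<le> ?Q x" if "0 < \<theta>" for \<theta>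
    using eventually_compose_filterlim[OF stopped_lower[OF that] scale] mean_pos by simp
  have le: "?Q x \<le> ?P x" for x
  proof (rule finite_measure_mono)
    show "{\<omega> \<in> space M. \<exists>k\<le>\<tau> \<omega>. (\<Sum>i\<in>{0<..k}. X i \<omega>) > x} \<in> events" by measurable
  qed blast
  show "?P \<sim>[at_top] (\<lambda>x. time_tail (x / a))"
  proof (rule asymp_equiv_sandwich[OF F_pos upper])
    show "\<forall>\<^sub>F x in at_top. (1 - \<theta>) * time_tail (x / a) \<le> ?P x" if "0 < \<theta>" for \<theta>
      using lower[OF that] by eventually_elim (rule order_trans[OF _ le])
  qed
  show "?Q \<sim>[at_top] (\<lambda>x. time_tail (x / a))"
  proof (rule asymp_equiv_sandwich[OF F_pos _ lower])
    show "\<forall>\<^sub>F x in at_top. ?Q x \<le> (1 + \<theta>) * time_tail (x / a)" if "0 < \<theta>" for \<theta>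
      using upper[OF that] by eventually_elim (rule order_trans[OF le])
  qed
qed

end

section \<open>Generated sigma-algebras and the theorem\<close>

lemma sets_gen_sigma: "sets (sigma \<Omega> (gen_sigma \<Omega> S)) = gen_sigma \<Omega> S"
proof -
  have "(\<Union>f\<in>S. {f -` A \<inter> \<Omega> |A. A \<in> sets borel}) \<subseteq> Pow \<Omega>" by auto
  from sigma_sets_into_sp[OF this] have "B \<subseteq> \<Omega>" if "B \<in> gen_sigma \<Omega> S" for B
    using that by (simp add: gen_sigma_def)
  then have "gen_sigma \<Omega> S \<subseteq> Pow \<Omega>" by (simp add: subset_iff)
  then have "sets (sigma \<Omega> (gen_sigma \<Omega> S)) = sigma_sets \<Omega> (gen_sigma \<Omega> S)"
    by (rule sets_measure_of)
  also have "\<dots> = gen_sigma \<Omega> S"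
    unfolding gen_sigma_def by (rule sigma_sets_sigma_sets_eq) auto
  finally show ?thesis .
qed

lemma gen_sigma_measurable:
  assumes "f \<in> S"
  shows "f \<in> borel_measurable (sigma \<Omega> (gen_sigma \<Omega> S))"
proof (rule measurableI)
  fix A :: "real set" assume "A \<in> sets borel"
  then have "f -` A \<inter> \<Omega> \<in> gen_sigma \<Omega> S"
    unfolding gen_sigma_def using assms by (intro sigma_sets.Basic) blast
  then show "f -` A \<inter> space (sigma \<Omega> (gen_sigma \<Omega> S)) \<in> sets (sigma \<Omega> (gen_sigma \<Omega> S))"
    by (simp add: sets_gen_sigma space_measure_of_conv)
qed simp

lemma gen_sigma_subset_sets:
  assumes "\<And>f. f \<in> S \<Longrightarrow> f \<in> borel_measurable M"
  shows "gen_sigma (space M) S \<subseteq> sets M"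
  unfolding gen_sigma_def
proof (intro sets.sigma_sets_subset subsetI)
  fix B assume "B \<in> (\<Union>f\<in>S. {f -` A \<inter> space M |A. A \<in> sets borel})"
  then obtain f A where "f \<in> S" "A \<in> sets borel" "B = f -` A \<inter> space M" by blast
  then show "B \<in> sets M" by (simp add: measurable_sets[OF assms])
qed

theorem theorem3:
  fixes M :: "'a measure" and \<xi> :: "'a \<Rightarrow> real" and X :: "nat \<Rightarrow> 'a \<Rightarrow> real"
    and \<tau> :: "'a \<Rightarrow> nat" and a :: real
  assumes "prob_space M"
    and "prob_space.indep_vars M (\<lambda>_. borel) X {1..}"
    and "\<And>n. n \<ge> 1 \<Longrightarrow> distr M borel (X n) = distr M borel \<xi>"
    and "integrable M \<xi>"
    and "a = integral\<^sup>L M \<xi>"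
    and "a > 0"
    and "\<tau> \<in> measurable M (count_space UNIV)"
    and "intermediate_regularly_varying (distr M borel (\<lambda>\<omega>. real (\<tau> \<omega>)))"
    and "(\<lambda>x::real. \<P>(\<omega> in M. \<bar>\<xi> \<omega>\<bar> > x)) \<in>
           o[at_top](\<lambda>x. \<P>(\<omega> in M. real (\<tau> \<omega>) > x) / (\<integral>\<omega>. min (real (\<tau> \<omega>)) x \<partial>M))"
    and "indep_of_future M X \<tau>"
  shows "(\<lambda>x::real. \<P>(\<omega> in M. running_max X (\<tau> \<omega>) \<omega> > x))
            \<sim>[at_top] (\<lambda>x. \<P>(\<omega> in M. partial_sum X (\<tau> \<omega>) \<omega> > x))
       \<and> (\<lambda>x::real. \<P>(\<omega> in M. partial_sum X (\<tau> \<omega>) \<omega> > x))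
            \<sim>[at_top] (\<lambda>x. \<P>(\<omega> in M. real (\<tau> \<omega>) > x / a))"
proof -
  interpret prob_space M by (rule assms(1))
  have [measurable]: "\<tau> \<in> measurable M (count_space UNIV)" by (rule assms(7))
  have X_meas: "X n \<in> borel_measurable M" if "0 < n" for n
    using assms(2) that by (auto simp: indep_vars_def)
  define early where
    "early n = gen_sigma (space M) (X ` {1..n} \<union> {indicator {\<omega>. \<tau> \<omega> \<le> n}})" for n
  define late where "late n = gen_sigma (space M) (X ` {n<..})" for n
  \<comment> \<open>The event \<open>{\<tau> = 0}\<close> is left out of the past of 0, which therefore is trivial and
    independent of every step.\<close>
  define past where
    "past n = (if n = 0 then sigma (space M) {} else sigma (space M) (early n))" for n
  define future where "future n = sigma (space M) (late n)" for n
  have indep: "indep_set (early n) (late n)" if "0 < n" for n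
    using assms(10) that by (simp add: indep_of_future_def early_def late_def)
  have sets_past: "sets (past n) = (if n = 0 then {{}, space M} else early n)" for n
    by (simp add: past_def early_def sets_gen_sigma sigma_sets_empty_eq)
  have sets_future: "sets (future n) = late n" for n
    by (simp add: future_def late_def sets_gen_sigma)
  have late_ev: "late n \<subseteq> events" for n
    unfolding late_def by (rule gen_sigma_subset_sets) (use X_meas in auto)
  have tail_eq: "tail (distr M borel (\<lambda>\<omega>. real (\<tau> \<omega>))) x = prob {\<omega> \<in> space M. x < real (\<tau> \<omega>)}" for x
  proof -
    have "(\<lambda>\<omega>. real (\<tau> \<omega>)) -` {x<..} \<inter> space M = {\<omega> \<in> space M. x < real (\<tau> \<omega>)}" by auto
    then show ?thesis unfolding tail_def by (subst measure_distr) auto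
  qed
  interpret stopped_walk M past future X \<xi> \<tau> a
  proof
    show "space (past n) = space M" "space (future n) = space M" for n
      by (simp_all add: past_def future_def space_measure_of_conv)
    show "sets (past n) \<subseteq> events" for n
      using indep_setD_ev1[OF indep] by (auto simp: sets_past)
    show "sets (future n) \<subseteq> events" for n
      by (simp add: sets_future late_ev)
    show "prob (A \<inter> B) = prob A * prob B"
      if A: "A \<in> sets (past n)" and B: "B \<in> sets (future n)" for A B n
    proof (cases "n = 0")
      case True
      have "B \<subseteq> space M" using B late_ev[of n] sets.sets_into_space by (auto simp: sets_future)
      then have "space M \<inter> B = B" by blast
      then show ?thesis using A True by (auto simp: sets_past prob_space)
    next
      case False
      then show ?thesis
        using A B indep_setD[OF indep] by (simp add: sets_past sets_future)
    qed
    show "X j \<in> borel_measurable (past i)" if "0 < j" "j \<le> i" for i j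
      using that unfolding past_def early_def by (auto intro!: gen_sigma_measurable)
    show "X j \<in> borel_measurable (future i)" if "i < j" for i j
      using that unfolding future_def late_def by (auto intro!: gen_sigma_measurable)
    show "distr M borel (X i) = distr M borel \<xi>" if "0 < i" for i
      using assms(3) that by simp
    show "{\<omega> \<in> space M. n < \<tau> \<omega>} \<in> sets (past n)" if "0 < n" for n
    proof -
      have "(indicator {\<omega>. \<tau> \<omega> \<le> n} :: 'a \<Rightarrow> real) \<in> borel_measurable (past n)"
        using that unfolding past_def early_def by (auto intro!: gen_sigma_measurable)
      then have "(indicator {\<omega>. \<tau> \<omega> \<le> n} :: 'a \<Rightarrow> real) -` {0} \<inter> space (past n) \<in> sets (past n)"
        by (rule measurable_sets) simp
      also have "(indicator {\<omega>. \<tau> \<omega> \<le> n} :: 'a \<Rightarrow> real) -` {0} \<inter> space (past n)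
          = {\<omega> \<in> space M. n < \<tau> \<omega>}"
        using that by (auto simp: past_def space_measure_of_conv indicator_def split: if_splits)
      finally show ?thesis .
    qed
    show "0 < prob {\<omega> \<in> space M. x < real (\<tau> \<omega>)}" for x
      using assms(8) by (simp add: intermediate_regularly_varying_def tail_eq)
    show "\<exists>r>0. r < 1 \<and> (\<forall>\<^sub>F x in at_top.
        prob {\<omega> \<in> space M. r * x < real (\<tau> \<omega>)} \<le> (1 + \<theta>) * prob {\<omega> \<in> space M. x < real (\<tau> \<omega>)})"
      if "0 < \<theta>" for \<theta>
      using intermediate_regularly_varyingD[OF assms(8) that] by (simp add: tail_eq)
  qed (use assms in auto)
  have sum_eq: "partial_sum X n \<omega> = (\<Sum>i\<in>{0<..n}. X i \<omega>)" for n \<omega>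
    by (simp add: partial_sum_def atLeastSucAtMost_greaterThanAtMost)
  have max_eq: "running_max X n \<omega> > x \<longleftrightarrow> (\<exists>k\<le>n. (\<Sum>i\<in>{0<..k}. X i \<omega>) > x)" for n \<omega> x
    by (auto simp: running_max_def sum_eq Max_gr_iff)
  show ?thesis
    using asymp_equiv_trans[OF max_asymp asymp_equiv_symI[OF sum_asymp]] sum_asymp
    by (simp add: max_eq sum_eq time_tail_def)
qed

end
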